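(* Let $I\subseteq\{1,\dots,N\}$ be nonempty and suppose $F_I^\circ\neq\varnothing$. For the product interaction, $F_I^\circ$ is accessible with respect to $g_\Pi$ if and only if $\sum_{i\in I}\alpha_i<2$. Consequently, it may happen (i.e. there are choices of the data) that every codimension-one hypersurface indexed by $I$ is individually accessible while the deeper open face $F_I^\circ$ is inaccessible. For the sum interaction, $F_I^\circ$ is accessible with respect to $g_\Sigma$ if and only if $\max_{i\in I}\alpha_i<2$. In particular, if $\alpha_i<2$ for every $i\in I$, then $F_I^\circ$ is accessible with respect to $g_\Sigma$.
   Context: Let $X$ be a compact smooth $n$-dimensional manifold with corners (locally modelled on $[0,\infty)^k\times\mathbb R^{n-k}$, $0\le k\le n$) whose boundary hypersurfaces $H_1,\dots,H_N$ are globally embedded, and let $X^\circ=X\setminus\partial X$. For each $i$ let $\rho_i:X\to[0,\infty)$ be a smooth boundary-defining function of $H_i$: $H_i=\rho_i^{-1}(0)$, $d\rho_i\neq0$ on $H_i$, and $\rho_i>0$ on $X\setminus H_i$. Let $g_0$ be a smooth Riemannian metric on $X$ (up to the boundary), and let $\alpha_1,\dots,\alpha_N\ge 0$. On $X^\circ$ put $g_\Pi=\bigl(\prod_{i=1}^N\rho_i^{-\alpha_i}\bigr)g_0$ (product interaction) and $g_\Sigma=\bigl(\sum_{i=1}^N\rho_i^{-\alpha_i}\bigr)g_0$ (sum interaction); $d_g$ is the Riemannian distance of $g$ on $X^\circ$. For $p\in X$, $I(p)=\{i: p\in H_i\}$ is the active index set, and $F_I^\circ=\{p\in X: I(p)=I\}$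 is the open face with active set $I$. A point $p\in\partial X$ is accessible with respect to $g$ if there is a $d_g$-Cauchy sequence in $X^\circ$ converging to $p$ in the topology of $X$. An open face is accessible with respect to $g$ if all of its points are, and inaccessible otherwise. Individual accessibility of the hypersurface $H_i$ means accessibility of the open face $F_{\{i\}}^\circ$, the set of points of $H_i$ lying on no other boundary hypersurface. *)

theory Defs
  imports "HOL-Analysis.Analysis"
begin

section \<open>Smooth maps on subsets of Euclidean space\<close>

text \<open>In finite dimension a map is $C^{k+1}$ on an open set iff it is differentiable there and all
  of its directional derivatives are $C^k$. The predicate is only meant for open sets.\<close>

primrec Ck_on :: "nat \<Rightarrow> ('a::euclidean_space \<Rightarrow> 'b::real_normed_vector) \<Rightarrow> 'a set \<Rightarrow> bool" where
  "Ck_on 0 f U \<longleftrightarrow> continuous_on U f"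
| "Ck_on (Suc k) f U \<longleftrightarrow>
     (\<forall>x\<in>U. f differentiable (at x)) \<and> (\<forall>v. Ck_on k (\<lambda>x. frechet_derivative f (at x) v) U)"

text \<open>On an arbitrary set (below: a relatively open subset of a corner model) smoothness means
  local extendability to a smooth map on an open subset of the ambient space.\<close>

definition smooth_within :: "('a::euclidean_space \<Rightarrow> 'b::real_normed_vector) \<Rightarrow> 'a set \<Rightarrow> bool" where
  "smooth_within f S \<longleftrightarrow>
     (\<forall>x\<in>S. \<exists>U F. open U \<and> x \<in> U \<and> (\<forall>k. Ck_on k F U) \<and> (\<forall>y\<in>S \<inter> U. F y = f y))"


section \<open>Manifolds with corners\<close>

text \<open>The model $[0,\infty)^k \times R^{n-k}$ with $n$ = \<open>DIM('e)\<close>: the \<open>k = card K\<close> coordinates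
  singled out by \<open>K \<subseteq> Basis\<close> are nonnegative.\<close>

definition corner_model :: "'e::euclidean_space set \<Rightarrow> 'e set" where
  "corner_model K = {x. \<forall>b\<in>K. 0 \<le> x \<bullet> b}"

record ('x, 'e) chart =
  chart_dom :: "'x set"
  chart_corner :: "'e set"
  chart_map :: "'x \<Rightarrow> 'e"

definition chart_image :: "('x, 'e) chart \<Rightarrow> 'e set" where
  "chart_image c = chart_map c ` chart_dom c"

definition chart_inv :: "('x, 'e) chart \<Rightarrow> 'e \<Rightarrow> 'x" where
  "chart_inv c = inv_into (chart_dom c) (chart_map c)"

definition is_chart :: "'x topology \<Rightarrow> ('x, 'e::euclidean_space) chart \<Rightarrow> bool" where
  "is_chart X c \<longleftrightarrow>
     openin X (chart_dom c) \<and> chart_corner c \<subseteq> Basis \<and>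
     openin (top_of_set (corner_model (chart_corner c))) (chart_image c) \<and>
     homeomorphic_map (subtopology X (chart_dom c)) (top_of_set (chart_image c)) (chart_map c)"

definition smooth_transition :: "('x, 'e::euclidean_space) chart \<Rightarrow> ('x, 'e) chart \<Rightarrow> bool" where
  "smooth_transition c c' \<longleftrightarrow>
     smooth_within (chart_map c' \<circ> chart_inv c) (chart_map c ` (chart_dom c \<inter> chart_dom c'))"

text \<open>The smooth structure is the one generated by the atlas \<open>A\<close>, which need not be maximal.\<close>

definition manifold_with_corners ::
    "'x topology \<Rightarrow> ('x, 'e::euclidean_space) chart set \<Rightarrow> bool" where
  "manifold_with_corners X A \<longleftrightarrow>
     Hausdorff_space X \<and> second_countable X \<and>
     (\<forall>c\<in>A. is_chart X c) \<and> (\<Union>c\<in>A. chart_dom c) = topspace X \<and>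
     (\<forall>c\<in>A. \<forall>c'\<in>A. smooth_transition c c')"

text \<open>The number of vanishing corner coordinates of a point does not depend on the chart.\<close>

definition depth_stratum ::
    "'x topology \<Rightarrow> ('x, 'e::euclidean_space) chart set \<Rightarrow> nat \<Rightarrow> 'x set" where
  "depth_stratum X A k =
     {p \<in> topspace X. \<exists>c\<in>A. p \<in> chart_dom c \<and>
        card {b \<in> chart_corner c. chart_map c p \<bullet> b = 0} = k}"

definition mfd_interior :: "'x topology \<Rightarrow> ('x, 'e::euclidean_space) chart set \<Rightarrow> 'x set" where
  "mfd_interior X A = depth_stratum X A 0"

definition boundary_hypersurfaces ::
    "'x topology \<Rightarrow> ('x, 'e::euclidean_space) chart set \<Rightarrow> 'x set set" where
  "boundary_hypersurfaces X A =
     (\<lambda>C. X closure_of C) ` connected_components_of (subtopology X (depth_stratum X A 1))"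

text \<open>No self-intersection: near each of its points, \<open>H\<close> is a single coordinate hyperplane.\<close>

definition embedded_hypersurface ::
    "'x topology \<Rightarrow> ('x, 'e::euclidean_space) chart set \<Rightarrow> 'x set \<Rightarrow> bool" where
  "embedded_hypersurface X A H \<longleftrightarrow>
     (\<forall>c\<in>A. \<forall>p\<in>H \<inter> chart_dom c. \<exists>b\<in>chart_corner c. \<exists>W. openin X W \<and> p \<in> W \<and>
        W \<subseteq> chart_dom c \<and> H \<inter> W = {q \<in> W. chart_map c q \<bullet> b = 0})"

definition smooth_fun :: "('x, 'e::euclidean_space) chart set \<Rightarrow> ('x \<Rightarrow> real) \<Rightarrow> bool" where
  "smooth_fun A f \<longleftrightarrow> (\<forall>c\<in>A. smooth_within (f \<circ> chart_inv c) (chart_image c))"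

text \<open>Derivatives within a chart image are unique, also at its boundary points, because the image
  is relatively open in a corner model.\<close>

definition differential_nonzero ::
    "('x, 'e::euclidean_space) chart set \<Rightarrow> ('x \<Rightarrow> real) \<Rightarrow> 'x \<Rightarrow> bool" where
  "differential_nonzero A f p \<longleftrightarrow>
     (\<forall>c\<in>A. p \<in> chart_dom c \<longrightarrow>
        (\<exists>D. ((f \<circ> chart_inv c) has_derivative D) (at (chart_map c p) within chart_image c) \<and>
             D \<noteq> (\<lambda>_. 0)))"

definition boundary_defining ::
    "'x topology \<Rightarrow> ('x, 'e::euclidean_space) chart set \<Rightarrow> 'x set \<Rightarrow> ('x \<Rightarrow> real) \<Rightarrow> bool" where
  "boundary_defining X A H \<rho> \<longleftrightarrow>
     smooth_fun A \<rho> \<and> H = {p \<in> topspace X. \<rho> p = 0} \<and>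
     (\<forall>p\<in>H. differential_nonzero A \<rho> p) \<and> (\<forall>p\<in>topspace X - H. 0 < \<rho> p)"


section \<open>Riemannian metrics and distance\<close>

text \<open>A 2-tensor field is given by its components: \<open>g c p u v\<close> is the value at \<open>p \<in> chart_dom c\<close> on
  the tangent vectors with coordinates \<open>u\<close> and \<open>v\<close> in the chart \<open>c\<close>. The last clause of
  \<open>riemannian_metric\<close> is the transformation law of a covariant tensor.\<close>

type_synonym ('x, 'e) tensor2 = "('x, 'e) chart \<Rightarrow> 'x \<Rightarrow> 'e \<Rightarrow> 'e \<Rightarrow> real"

definition riemannian_metric ::
    "('x, 'e::euclidean_space) chart set \<Rightarrow> ('x, 'e) tensor2 \<Rightarrow> bool" where
  "riemannian_metric A g \<longleftrightarrow>
     (\<forall>c\<in>A. \<forall>p\<in>chart_dom c.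
        bilinear (g c p) \<and> (\<forall>u v. g c p u v = g c p v u) \<and> (\<forall>u. u \<noteq> 0 \<longrightarrow> 0 < g c p u u)) \<and>
     (\<forall>c\<in>A. \<forall>u v. smooth_within (\<lambda>x. g c (chart_inv c x) u v) (chart_image c)) \<and>
     (\<forall>c\<in>A. \<forall>c'\<in>A. \<forall>p\<in>chart_dom c \<inter> chart_dom c'. \<forall>D.
        ((chart_map c' \<circ> chart_inv c) has_derivative D)
          (at (chart_map c p) within chart_map c ` (chart_dom c \<inter> chart_dom c')) \<longrightarrow>
        (\<forall>u v. g c p u v = g c' p (D u) (D v)))"

definition conformal :: "('x \<Rightarrow> real) \<Rightarrow> ('x, 'e) tensor2 \<Rightarrow> ('x, 'e) tensor2" where
  "conformal w g = (\<lambda>c p u v. w p * g c p u v)"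

definition C1_curve ::
    "'x topology \<Rightarrow> ('x, 'e::euclidean_space) chart set \<Rightarrow> (real \<Rightarrow> 'x) \<Rightarrow> real \<Rightarrow> real \<Rightarrow> bool" where
  "C1_curve X A \<gamma> a b \<longleftrightarrow>
     continuous_map (top_of_set {a..b}) X \<gamma> \<and>
     (\<forall>c\<in>A. \<exists>D. continuous_on {t\<in>{a..b}. \<gamma> t \<in> chart_dom c} D \<and>
        (\<forall>t\<in>{a..b}. \<gamma> t \<in> chart_dom c \<longrightarrow>
           ((chart_map c \<circ> \<gamma>) has_vector_derivative D t) (at t within {a..b})))"

definition piecewise_C1_curve ::
    "'x topology \<Rightarrow> ('x, 'e::euclidean_space) chart set \<Rightarrow> (real \<Rightarrow> 'x) \<Rightarrow> bool" where
  "piecewise_C1_curve X A \<gamma> \<longleftrightarrow>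
     (\<exists>(m::nat) (\<tau>::nat \<Rightarrow> real). \<tau> 0 = 0 \<and> \<tau> m = 1 \<and>
        (\<forall>k<m. \<tau> k < \<tau> (Suc k) \<and> C1_curve X A \<gamma> (\<tau> k) (\<tau> (Suc k))))"

text \<open>The norm of the velocity, computed in any chart around \<open>\<gamma> t\<close>. It is unspecified at the
  finitely many parameters where a piecewise $C^1$ curve is not differentiable, which does not
  affect the length.\<close>

definition speed ::
    "('x, 'e::euclidean_space) chart set \<Rightarrow> ('x, 'e) tensor2 \<Rightarrow> (real \<Rightarrow> 'x) \<Rightarrow> real \<Rightarrow> real" where
  "speed A g \<gamma> t =
     (THE s. \<exists>c\<in>A. \<exists>v. \<gamma> t \<in> chart_dom c \<and>
        ((chart_map c \<circ> \<gamma>) has_vector_derivative v) (at t) \<and> s = sqrt (g c (\<gamma> t) v v))"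

definition curve_length ::
    "('x, 'e::euclidean_space) chart set \<Rightarrow> ('x, 'e) tensor2 \<Rightarrow> (real \<Rightarrow> 'x) \<Rightarrow> ennreal" where
  "curve_length A g \<gamma> = (\<integral>\<^sup>+t\<in>{0..1}. ennreal (speed A g \<gamma> t) \<partial>lborel)"

text \<open>The Riemannian distance of a metric \<open>g\<close> on the interior: only curves that stay in the
  interior compete. It is infinite between different components.\<close>

definition riem_dist ::
    "'x topology \<Rightarrow> ('x, 'e::euclidean_space) chart set \<Rightarrow> ('x, 'e) tensor2 \<Rightarrow> 'x \<Rightarrow> 'x \<Rightarrow> ennreal"
  where
  "riem_dist X A g p q =
     (INF \<gamma>\<in>{\<gamma>. piecewise_C1_curve X A \<gamma> \<and> \<gamma> ` {0..1} \<subseteq> mfd_interior X A \<and> \<gamma> 0 = p \<and> \<gamma> 1 = q}.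
        curve_length A g \<gamma>)"


section \<open>Accessibility\<close>

definition accessible_point ::
    "'x topology \<Rightarrow> ('x, 'e::euclidean_space) chart set \<Rightarrow> ('x, 'e) tensor2 \<Rightarrow> 'x \<Rightarrow> bool" where
  "accessible_point X A g p \<longleftrightarrow>
     (\<exists>s::nat \<Rightarrow> 'x. (\<forall>n. s n \<in> mfd_interior X A) \<and>
        (\<forall>\<epsilon>>0. \<exists>M. \<forall>m\<ge>M. \<forall>n\<ge>M. riem_dist X A g (s m) (s n) < \<epsilon>) \<and>
        limitin X s p sequentially)"

definition accessible ::
    "'x topology \<Rightarrow> ('x, 'e::euclidean_space) chart set \<Rightarrow> ('x, 'e) tensor2 \<Rightarrow> 'x set \<Rightarrow> bool" where
  "accessible X A g F \<longleftrightarrow> (\<forall>p\<in>F. accessible_point X A g p)"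

definition active_set :: "nat \<Rightarrow> (nat \<Rightarrow> 'x set) \<Rightarrow> 'x \<Rightarrow> nat set" where
  "active_set N H p = {i \<in> {1..N}. p \<in> H i}"

definition open_face :: "'x topology \<Rightarrow> nat \<Rightarrow> (nat \<Rightarrow> 'x set) \<Rightarrow> nat set \<Rightarrow> 'x set" where
  "open_face X N H I = {p \<in> topspace X. active_set N H p = I}"


section \<open>The standing data and the two interactions\<close>

definition corner_data ::
    "'x topology \<Rightarrow> ('x, 'e::euclidean_space) chart set \<Rightarrow> nat \<Rightarrow> (nat \<Rightarrow> 'x set) \<Rightarrow>
     (nat \<Rightarrow> 'x \<Rightarrow> real) \<Rightarrow> ('x, 'e) tensor2 \<Rightarrow> (nat \<Rightarrow> real) \<Rightarrow> bool" where
  "corner_data X A N H \<rho> g\<^sub>0 \<alpha> \<longleftrightarrow>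
     manifold_with_corners X A \<and> compact_space X \<and>
     bij_betw H {1..N} (boundary_hypersurfaces X A) \<and>
     (\<forall>i\<in>{1..N}. embedded_hypersurface X A (H i) \<and> boundary_defining X A (H i) (\<rho> i)) \<and>
     riemannian_metric A g\<^sub>0 \<and> (\<forall>i\<in>{1..N}. 0 \<le> \<alpha> i)"

definition product_metric ::
    "nat \<Rightarrow> (nat \<Rightarrow> 'x \<Rightarrow> real) \<Rightarrow> (nat \<Rightarrow> real) \<Rightarrow> ('x, 'e) tensor2 \<Rightarrow> ('x, 'e) tensor2" where
  "product_metric N \<rho> \<alpha> g\<^sub>0 = conformal (\<lambda>p. \<Prod>i=1..N. \<rho> i p powr (- \<alpha> i)) g\<^sub>0"

definition sum_metric ::
    "nat \<Rightarrow> (nat \<Rightarrow> 'x \<Rightarrow> real) \<Rightarrow> (nat \<Rightarrow> real) \<Rightarrow> ('x, 'e) tensor2 \<Rightarrow> ('x, 'e) tensor2" where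
  "sum_metric N \<rho> \<alpha> g\<^sub>0 = conformal (\<lambda>p. \<Sum>i=1..N. \<rho> i p powr (- \<alpha> i)) g\<^sub>0"

end

theory Submission
  imports Defs
begin

text \<open>Inaccessibility: if $R$ is the sum of the \<open>\<rho> i\<close> over \<open>i \<in> I\<close>, then the conformal factor is
  bounded below by a multiple of $R^{-2}$ when the exponents add up to at least $2$, while $dR$ is
  $g_0$-bounded on the compact manifold. Hence $\ln R$ is Lipschitz on the whole interior for the
  conformal metric, and it tends to $-\infty$ at the face, so no sequence converging to the face is
  Cauchy. For the sum interaction a single \<open>\<rho> i\<close> plays the role of $R$.

  Accessibility: along the ray that leaves \<open>p\<close> in the direction of the sum of its active corner
  coordinates, each active \<open>\<rho> i\<close> grows at least linearly in the parameter $t$, so the conformal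
  speed is $O(t^{-s/2})$ with $s < 2$, which is integrable.

  The example is the unit square with all exponents equal to $1$.\<close>

section \<open>Smooth functions along curves\<close>

text \<open>The distance is an infimum over all curves in the interior, including those that stay
  far from the face, so an estimate near the face alone would not bound it from below. Comparing the
  weight with $R^{-2}$ on the whole interior costs only a constant, because every
  \<open>\<rho> i\<close> is bounded and every exponent is nonnegative. The power $2$ is the
  threshold because the square root of the weight then dominates a multiple of $1/R$, the derivative
  of the logarithm.

  Linear growth along the ray comes from the shape of the differential: a boundary-defining function
  vanishes on a coordinate hyperplane and is nonnegative, so its differential there is a positive
  multiple of that one coordinate.

  Two features of the setting shape the details. Smoothness up to the boundary means local
  extendability, so derivatives are taken of extensions and carried back along curves. The speed is
  a definite description over all charts, so its independence of the chart comes before any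
  estimate; its measurability is not known, so lengths are bounded from below through measurable
  minorants.\<close>

lemma smooth_withinE:
  assumes "smooth_within f S" "x \<in> S"
  obtains U F where "open U" "x \<in> U" "\<And>y. y \<in> U \<Longrightarrow> F differentiable (at y)"
    "\<And>v. continuous_on U (\<lambda>y. frechet_derivative F (at y) v)"
    "\<And>y. y \<in> S \<inter> U \<Longrightarrow> F y = f y"
proof -
  obtain U F where U: "open U" "x \<in> U" "\<forall>k. Ck_on k F U" "\<forall>y\<in>S \<inter> U. F y = f y"
    using assms unfolding smooth_within_def by meson
  \<comment> \<open>Of the smoothness of the extension only the case \<open>k = 1\<close> is ever
    used.\<close>
  have "Ck_on (Suc 0) F U" using U by blast
  then have "\<forall>y\<in>U. F differentiable (at y)" "\<forall>v. continuous_on U (\<lambda>y. frechet_derivative F (at y) v)"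
    by simp_all
  with U that show thesis by blast
qed

text \<open>Continuity of the derivative is known only for a fixed direction; the expansion in the
  basis lets the base point and the direction vary together, and it also bounds the derivative by
  finitely many partial derivatives.\<close>

lemma frechet_derivative_sum_Basis:
  assumes "F differentiable (at y)"
  shows "frechet_derivative F (at y) v = (\<Sum>b\<in>Basis. (v \<bullet> b) *\<^sub>R frechet_derivative F (at y) b)"
proof -
  have l: "linear (frechet_derivative F (at y))"
    using assms linear_frechet_derivative by blast
  have "frechet_derivative F (at y) v = frechet_derivative F (at y) (\<Sum>b\<in>Basis. (v \<bullet> b) *\<^sub>R b)"
    by (simp add: euclidean_representation)
  then show ?thesis by (simp add: linear_sum[OF l] linear_cmul[OF l])
qed


text \<open>As \<open>a < b\<close>, a derivative within \<open>{a..b}\<close> is unique, also at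
  the endpoints. The local derivatives therefore all agree with \<open>vector_derivative\<close>,
  which inherits their continuity.\<close>

lemma vector_derivative_patch:
  fixes y :: "real \<Rightarrow> 'b::real_normed_vector"
  assumes ab: "a < b" and sub: "T0 \<subseteq> {a..b}"
    and loc: "\<And>t0. t0 \<in> T0 \<Longrightarrow> \<exists>N d. openin (top_of_set {a..b}) N \<and> t0 \<in> N \<and> N \<subseteq> T0 \<and>
      continuous_on N d \<and> (\<forall>t\<in>N. (y has_vector_derivative d t) (at t within {a..b}))"
  obtains y' where "continuous_on T0 y'"
    "\<And>t. t \<in> T0 \<Longrightarrow> (y has_vector_derivative y' t) (at t within {a..b})"
proof -
  define y' where "y' t = vector_derivative y (at t within {a..b})" for t
  have y': "(y has_vector_derivative y' t) (at t within {a..b})" if "t \<in> T0" for t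
    using loc[OF that] unfolding y'_def by (metis vector_derivative_works differentiableI_vector)
  have "continuous_on T0 y'"
    unfolding continuous_on_eq_continuous_within
  proof
    fix t0 assume t0: "t0 \<in> T0"
    obtain N g where N: "openin (top_of_set {a..b}) N" "t0 \<in> N" "N \<subseteq> T0" and cg: "continuous_on N g"
      and g: "\<And>t. t\<in>N \<Longrightarrow> (y has_vector_derivative g t) (at t within {a..b})"
      using loc[OF t0] by blast
    have "y' t = g t" if "t \<in> N" for t
      using vector_derivative_within_cbox[of a b t y "g t"] g[OF that] ab that N sub
      unfolding y'_def by auto
    then have "continuous_on N y'" using cg by (simp cong: continuous_on_cong)
    then have "continuous (at t0 within N) y'" using N continuous_on_eq_continuous_within by blast
    moreover obtain V where V: "open V" "N = {a..b} \<inter> V" using N by (auto simp: openin_open)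
    have "at t0 within T0 = at t0 within N"
      by (rule at_within_nhd[of _ V]) (use V N sub in auto)
    ultimately show "continuous (at t0 within T0) y'" by simp
  qed
  with y' show thesis using that by blast
qed

text \<open>Chain rule for a map that is given only on a corner domain: near each parameter
  \<open>y\<close> equals \<open>F \<circ> x\<close> for a local extension \<open>F\<close>, and the
  local derivatives are patched. It is applied to functions read in a chart and to transition
  maps.\<close>

lemma smooth_curve:
  fixes x :: "real \<Rightarrow> 'a::euclidean_space" and y :: "real \<Rightarrow> 'b::real_normed_vector"
  assumes f: "smooth_within f S" and ab: "a < b" and T0: "openin (top_of_set {a..b}) T0"
    and xS: "\<And>t. t \<in> T0 \<Longrightarrow> x t \<in> S" and yf: "\<And>t. t \<in> T0 \<Longrightarrow> y t = f (x t)"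
    and x': "\<And>t. t \<in> T0 \<Longrightarrow> (x has_vector_derivative x' t) (at t within {a..b})"
    and cx': "continuous_on T0 x'"
  obtains y' where "continuous_on T0 y'"
    "\<And>t. t \<in> T0 \<Longrightarrow> (y has_vector_derivative y' t) (at t within {a..b})"
proof -
  have sub: "T0 \<subseteq> {a..b}" using T0 openin_imp_subset by blast
  have cx: "continuous_on T0 x"
    unfolding continuous_on_eq_continuous_within
    using x' sub by (meson continuous_within_subset has_vector_derivative_continuous)
  have loc: "\<exists>N g. openin (top_of_set {a..b}) N \<and> t0 \<in> N \<and> N \<subseteq> T0 \<and> continuous_on N g \<and>
     (\<forall>t\<in>N. (y has_vector_derivative g t) (at t within {a..b}))" if t0: "t0 \<in> T0" for t0
  proof -
    obtain U F where U: "open U" "x t0 \<in> U" and dF: "\<And>z. z \<in> U \<Longrightarrow> F differentiable (at z)"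
      and cF: "\<And>v. continuous_on U (\<lambda>y. frechet_derivative F (at y) v)"
      and Ff: "\<And>z. z \<in> S \<inter> U \<Longrightarrow> F z = f z"
      using smooth_withinE[OF f xS[OF t0]] by metis
    define N where "N = T0 \<inter> x -` U"
    have N: "openin (top_of_set {a..b}) N" "t0 \<in> N" "N \<subseteq> T0"
      using T0 continuous_openin_preimage_gen[OF cx U(1)] U t0
      unfolding N_def by (auto intro: openin_trans)
    define g where "g t = frechet_derivative F (at (x t)) (x' t)" for t
    have "continuous_on N (\<lambda>t. \<Sum>b\<in>Basis. (x' t \<bullet> b) *\<^sub>R frechet_derivative F (at (x t)) b)"
      by (intro continuous_intros continuous_on_compose2[OF cF] continuous_on_subset[OF cx]
          continuous_on_subset[OF cx']) (auto simp: N_def)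
    moreover have "g t = (\<Sum>b\<in>Basis. (x' t \<bullet> b) *\<^sub>R frechet_derivative F (at (x t)) b)" if "t \<in> N" for t
      unfolding g_def by (rule frechet_derivative_sum_Basis) (use that dF in \<open>auto simp: N_def\<close>)
    ultimately have cg: "continuous_on N g" by (simp cong: continuous_on_cong)
    have "(y has_vector_derivative g t) (at t within {a..b})" if t: "t \<in> N" for t
    proof -
      have "(F has_derivative frechet_derivative F (at (x t))) (at (x t))"
        using dF t by (simp add: N_def frechet_derivative_works[symmetric])
      then have "((F \<circ> x) has_vector_derivative g t) (at t within {a..b})"
        unfolding g_def
        by (rule vector_derivative_diff_chain_within[OF x' has_derivative_at_withinI, rotated])
          (use t in \<open>auto simp: N_def\<close>)
      moreover have "eventually (\<lambda>s. s \<in> N) (at t within {a..b})"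
        using N(1) t by (auto simp: openin_open eventually_at_filter intro: eventually_mono[OF eventually_nhds_in_open])
      then have "eventually (\<lambda>s. (F \<circ> x) s = y s) (at t within {a..b})"
        by eventually_elim (use Ff xS yf in \<open>auto simp: N_def\<close>)
      moreover have "(F \<circ> x) t = y t" using t Ff xS yf by (auto simp: N_def)
      ultimately show ?thesis
        unfolding has_vector_derivative_def by (rule has_derivative_transform_eventually)
          (use t N sub in auto)
    qed
    with N cg show ?thesis by blast
  qed
  show thesis
    by (rule vector_derivative_patch[OF ab sub loc]) (use that in auto)
qed

section \<open>Charts, velocity and gradient bounds\<close>

lemma eventually_isCont_in_open:
  assumes "isCont h t" "open U" "h t \<in> U"
  shows "eventually (\<lambda>s. h s \<in> U) (nhds t)"
  using assms topological_tendstoD[of h "h t" "nhds t" U]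
  by (simp add: isCont_def tendsto_at_iff_tendsto_nhds)

lemma smooth_within_continuous_on:
  assumes "smooth_within f S"
  shows "continuous_on S f"
  unfolding continuous_on_eq_continuous_within
proof
  fix x assume x: "x \<in> S"
  obtain U F where U: "open U" "x \<in> U" "\<And>y. y \<in> U \<Longrightarrow> F differentiable (at y)"
    and Ff: "\<And>y. y \<in> S \<inter> U \<Longrightarrow> F y = f y"
    using smooth_withinE[OF assms x] by metis
  have "continuous (at x within S \<inter> U) F"
    using U by (simp add: continuous_at_imp_continuous_at_within differentiable_imp_continuous_within)
  then have "continuous (at x within S \<inter> U) f"
    by (rule continuous_transform_within[OF _ zero_less_one]) (use x U Ff in auto)
  moreover have "at x within S \<inter> U = at x within S"
    by (rule at_within_nhd[of _ U]) (use U in auto)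
  ultimately show "continuous (at x within S) f" by simp
qed

text \<open>Cited below by position as \<open>ch\<close>: facts \<open>4\<close> to \<open>7\<close>
  make \<open>chart_map\<close> and \<open>chart_inv\<close> mutually inverse between domain and
  image, facts \<open>8\<close> and \<open>9\<close> give their continuity.\<close>

lemma is_chartD:
  assumes "is_chart X c"
  shows "openin X (chart_dom c)" and "chart_corner c \<subseteq> Basis"
    and "openin (top_of_set (corner_model (chart_corner c))) (chart_image c)"
    and "\<And>q. q \<in> chart_dom c \<Longrightarrow> chart_inv c (chart_map c q) = q"
    and "\<And>q. q \<in> chart_dom c \<Longrightarrow> chart_map c q \<in> chart_image c"
    and "\<And>x. x \<in> chart_image c \<Longrightarrow> chart_map c (chart_inv c x) = x"
    and "\<And>x. x \<in> chart_image c \<Longrightarrow> chart_inv c x \<in> chart_dom c"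
    and "continuous_map (subtopology X (chart_dom c)) euclidean (chart_map c)"
    and "continuous_map (top_of_set (chart_image c)) X (chart_inv c)"
proof -
  show op: "openin X (chart_dom c)" "chart_corner c \<subseteq> Basis"
    "openin (top_of_set (corner_model (chart_corner c))) (chart_image c)"
    using assms by (auto simp: is_chart_def)
  have h: "homeomorphic_map (subtopology X (chart_dom c)) (top_of_set (chart_image c)) (chart_map c)"
    using assms by (simp add: is_chart_def)
  have ts: "topspace (subtopology X (chart_dom c)) = chart_dom c"
    using openin_subset[OF op(1)] by auto
  have inj: "inj_on (chart_map c) (chart_dom c)"
    using homeomorphic_imp_injective_map[OF h] ts by simp
  show 1: "\<And>q. q \<in> chart_dom c \<Longrightarrow> chart_inv c (chart_map c q) = q"
    using inj by (simp add: chart_inv_def)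
  show "\<And>q. q \<in> chart_dom c \<Longrightarrow> chart_map c q \<in> chart_image c"
    by (simp add: chart_image_def)
  show 2: "\<And>x. x \<in> chart_image c \<Longrightarrow> chart_map c (chart_inv c x) = x"
    by (simp add: chart_image_def chart_inv_def f_inv_into_f)
  show 3: "\<And>x. x \<in> chart_image c \<Longrightarrow> chart_inv c x \<in> chart_dom c"
    by (simp add: chart_image_def chart_inv_def inv_into_into)
  show "continuous_map (subtopology X (chart_dom c)) euclidean (chart_map c)"
    using homeomorphic_imp_continuous_map[OF h] by (simp add: continuous_map_in_subtopology)
  obtain g where g: "homeomorphic_maps (subtopology X (chart_dom c)) (top_of_set (chart_image c)) (chart_map c) g"
    using h by (auto simp: homeomorphic_map_maps)
  have "g x = chart_inv c x" if "x \<in> chart_image c" for x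
    using g that 1 2 3 ts unfolding homeomorphic_maps_def
    by (metis topspace_euclidean_subtopology continuous_map_image_subset_topspace image_subset_iff)
  moreover have "continuous_map (top_of_set (chart_image c)) X g"
    using g by (auto simp: homeomorphic_maps_def continuous_map_in_subtopology)
  ultimately show "continuous_map (top_of_set (chart_image c)) X (chart_inv c)"
    by (smt (verit) continuous_map_eq topspace_euclidean_subtopology)
qed

section \<open>Independence of the speed from the chart\<close>

locale riemannian_corner_manifold =
  fixes X :: "'x topology" and A :: "('x, 'e::euclidean_space) chart set" and g :: "('x, 'e) tensor2"
  assumes manifold: "manifold_with_corners X A" and metric: "riemannian_metric A g"
begin

lemma chart: "c \<in> A \<Longrightarrow> is_chart X c"
  using manifold by (auto simp: manifold_with_corners_def)

lemma ex_chart: "p \<in> topspace X \<Longrightarrow> \<exists>c\<in>A. p \<in> chart_dom c"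
  using manifold by (auto simp: manifold_with_corners_def)

lemma transition: "c \<in> A \<Longrightarrow> c' \<in> A \<Longrightarrow> smooth_transition c c'"
  using manifold by (auto simp: manifold_with_corners_def)

lemma metric_at:
  assumes "c \<in> A" "q \<in> chart_dom c"
  shows "bilinear (g c q)" and "u \<noteq> 0 \<Longrightarrow> 0 < g c q u u"
  using metric assms by (auto simp: riemannian_metric_def)

lemma metric_scale:
  assumes "c \<in> A" "q \<in> chart_dom c"
  shows "g c q (k *\<^sub>R u) (k *\<^sub>R u) = k\<^sup>2 * g c q u u"
  using metric_at(1)[OF assms] by (simp add: bilinear_lmul bilinear_rmul power2_eq_square)

lemma metric_nonneg:
  assumes "c \<in> A" "q \<in> chart_dom c"
  shows "0 \<le> g c q u u"
  using metric_at[OF assms] by (cases "u = 0") (auto simp: bilinear_lzero less_imp_le)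

lemma metric_smooth:
  "c \<in> A \<Longrightarrow> smooth_within (\<lambda>x. g c (chart_inv c x) u v) (chart_image c)"
  using metric by (auto simp: riemannian_metric_def)

text \<open>The transformation law speaks of any derivative of the transition map within the
  overlap. The derivative \<open>D\<close> of a local extension is one, and the chain rule along the
  curve gives \<open>D v = v'\<close>. The hypothesis \<open>near\<close> keeps the curve inside
  both domains for parameters close to \<open>t\<close>, which is where the extension and the
  transition map can be compared.\<close>

lemma velocity_transform:
  assumes c: "c \<in> A" "\<gamma> t \<in> chart_dom c" and c': "c' \<in> A" "\<gamma> t \<in> chart_dom c'"
    and near: "\<And>c. c \<in> A \<Longrightarrow> \<gamma> t \<in> chart_dom c \<Longrightarrow> eventually (\<lambda>s. \<gamma> s \<in> chart_dom c) (nhds t)"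
    and v: "((chart_map c \<circ> \<gamma>) has_vector_derivative v) (at t)"
    and v': "((chart_map c' \<circ> \<gamma>) has_vector_derivative v') (at t)"
  shows "g c (\<gamma> t) v v = g c' (\<gamma> t) v' v'"
proof -
  define S where "S = chart_map c ` (chart_dom c \<inter> chart_dom c')"
  define \<phi> where "\<phi> = chart_map c' \<circ> chart_inv c"
  note ch = is_chartD[OF chart[OF c(1)]]
  have sm: "smooth_within \<phi> S"
    using transition[OF c(1) c'(1)] by (simp add: smooth_transition_def S_def \<phi>_def)
  have x0: "chart_map c (\<gamma> t) \<in> S" using c c' by (auto simp: S_def)
  obtain U F where U: "open U" "chart_map c (\<gamma> t) \<in> U"
    and dF: "\<And>y. y \<in> U \<Longrightarrow> F differentiable (at y)"
    and F: "\<And>y. y \<in> S \<inter> U \<Longrightarrow> F y = \<phi> y"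
    using smooth_withinE[OF sm x0] by metis
  define D where "D = frechet_derivative F (at (chart_map c (\<gamma> t)))"
  have D: "(F has_derivative D) (at (chart_map c (\<gamma> t)))"
    using dF U by (simp add: D_def frechet_derivative_works[symmetric])
  have "eventually (\<lambda>y. y \<in> S \<longrightarrow> F y = \<phi> y) (nhds (chart_map c (\<gamma> t)))"
    using eventually_nhds_in_open[OF U] by eventually_elim (use F in auto)
  then have "eventually (\<lambda>y. F y = \<phi> y) (at (chart_map c (\<gamma> t)) within S)"
    by (auto simp: eventually_at_filter elim: eventually_mono)
  then have "(\<phi> has_derivative D) (at (chart_map c (\<gamma> t)) within S)"
    by (rule has_derivative_transform_eventually[OF has_derivative_at_withinI[OF D]])
       (use F x0 U in auto)
  then have law: "g c (\<gamma> t) v v = g c' (\<gamma> t) (D v) (D v)"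
    using metric c c' unfolding riemannian_metric_def S_def \<phi>_def by blast
  have comp: "((F \<circ> (chart_map c \<circ> \<gamma>)) has_vector_derivative D v) (at t)"
    using vector_derivative_diff_chain_within[OF v, of F D] D
    by (simp add: has_derivative_at_withinI)
  have "isCont (chart_map c \<circ> \<gamma>) t"
    using v has_vector_derivative_continuous by blast
  then have "eventually (\<lambda>s. chart_map c (\<gamma> s) \<in> U) (nhds t)"
    using eventually_isCont_in_open[of t "chart_map c \<circ> \<gamma>" U] U by simp
  then have ev: "eventually (\<lambda>s. (F \<circ> (chart_map c \<circ> \<gamma>)) s = (chart_map c' \<circ> \<gamma>) s) (nhds t)"
    using near[OF c] near[OF c']
    by eventually_elim (use ch(4) F in \<open>auto simp: S_def \<phi>_def\<close>)
  then have "((chart_map c' \<circ> \<gamma>) has_vector_derivative D v) (at t)"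
    using comp has_vector_derivative_cong_ev[of UNIV "F \<circ> (chart_map c \<circ> \<gamma>)" "chart_map c' \<circ> \<gamma>" t]
      eventually_nhds_x_imp_x[OF ev] by auto
  then have "D v = v'" using v' vector_derivative_unique_at by blast
  with law show ?thesis by simp
qed

text \<open>Resolves the definite description in \<open>speed\<close>: all candidates coincide by
  \<open>velocity_transform\<close>, and the weight depends on the point only.\<close>

lemma speed_eq:
  assumes c: "c \<in> A" "\<gamma> t \<in> chart_dom c"
    and near: "\<And>c. c \<in> A \<Longrightarrow> \<gamma> t \<in> chart_dom c \<Longrightarrow> eventually (\<lambda>s. \<gamma> s \<in> chart_dom c) (nhds t)"
    and v: "((chart_map c \<circ> \<gamma>) has_vector_derivative v) (at t)"
  shows "speed A (conformal w g) \<gamma> t = sqrt (w (\<gamma> t) * g c (\<gamma> t) v v)"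
proof -
  have "(\<exists>c\<in>A. \<exists>v. \<gamma> t \<in> chart_dom c \<and> ((chart_map c \<circ> \<gamma>) has_vector_derivative v) (at t) \<and>
      s = sqrt (w (\<gamma> t) * g c (\<gamma> t) v v)) \<longleftrightarrow> s = sqrt (w (\<gamma> t) * g c (\<gamma> t) v v)"
    (is "?ex s \<longleftrightarrow> _") for s
  proof
    assume "?ex s"
    then obtain c' v' where c': "c' \<in> A" "\<gamma> t \<in> chart_dom c'"
      and v': "((chart_map c' \<circ> \<gamma>) has_vector_derivative v') (at t)"
      and s: "s = sqrt (w (\<gamma> t) * g c' (\<gamma> t) v' v')" by blast
    have "g c (\<gamma> t) v v = g c' (\<gamma> t) v' v'"
      by (rule velocity_transform[OF c c' _ v v']) (rule near)
    with s show "s = sqrt (w (\<gamma> t) * g c (\<gamma> t) v v)" by simp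
  next
    assume "s = sqrt (w (\<gamma> t) * g c (\<gamma> t) v v)"
    with c v show "?ex s" by blast
  qed
  note iff = this
  show ?thesis unfolding speed_def conformal_def iff by (rule the_eq_trivial)
qed

text \<open>Restricted to interior parameters: a neighbourhood of an endpoint contains parameters
  outside \<open>{a..b}\<close>, where nothing is known about the curve.\<close>

lemma C1_curve_near:
  assumes \<gamma>: "C1_curve X A \<gamma> a b" and t: "a < t" "t < b" and c: "c \<in> A" "\<gamma> t \<in> chart_dom c"
  shows "eventually (\<lambda>s. \<gamma> s \<in> chart_dom c) (nhds t)"
proof -
  have "openin (top_of_set {a..b}) {s \<in> {a..b}. \<gamma> s \<in> chart_dom c}"
    using openin_continuous_map_preimage[OF _ is_chartD(1)[OF chart[OF c(1)]], of "top_of_set {a..b}" \<gamma>] \<gamma>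
    by (simp add: C1_curve_def)
  then obtain V where V: "open V" "{s \<in> {a..b}. \<gamma> s \<in> chart_dom c} = {a..b} \<inter> V"
    unfolding openin_open by blast
  have "open ({a<..<b} \<inter> V)" "t \<in> {a<..<b} \<inter> V"
    using V(1) equalityD1[OF V(2)] t c by auto
  moreover have "\<gamma> s \<in> chart_dom c" if "s \<in> {a<..<b} \<inter> V" for s
  proof -
    have "s \<in> {a..b} \<inter> V" using that by auto
    then show ?thesis unfolding V(2)[symmetric] by blast
  qed
  ultimately show ?thesis by (metis (no_types, lifting) eventually_mono eventually_nhds_in_open)
qed

lemma C1_curve_in: "C1_curve X A \<gamma> a b \<Longrightarrow> t \<in> {a..b} \<Longrightarrow> \<gamma> t \<in> topspace X"
  by (auto simp: C1_curve_def continuous_map_def)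

lemma C1_curve_velocity:
  assumes \<gamma>: "C1_curve X A \<gamma> a b" and t: "a < t" "t < b" and c: "c \<in> A" "\<gamma> t \<in> chart_dom c"
  obtains v where "((chart_map c \<circ> \<gamma>) has_vector_derivative v) (at t)"
proof -
  have "t \<in> {a..b}" using t by auto
  then obtain v where "((chart_map c \<circ> \<gamma>) has_vector_derivative v) (at t within {a..b})"
    using \<gamma> c unfolding C1_curve_def by blast
  moreover have "at t within {a..b} = at t" using t by (simp add: at_within_Icc_at)
  ultimately show thesis using that by simp
qed

lemma speed_conformal:
  assumes \<gamma>: "C1_curve X A \<gamma> a b" and t: "a < t" "t < b"
  shows "speed A (conformal w g) \<gamma> t = sqrt (w (\<gamma> t)) * speed A g \<gamma> t"
proof -
  have "\<gamma> t \<in> topspace X" using C1_curve_in[OF \<gamma>] t by auto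
  then obtain c where c: "c \<in> A" "\<gamma> t \<in> chart_dom c" using ex_chart by blast
  obtain v where v: "((chart_map c \<circ> \<gamma>) has_vector_derivative v) (at t)"
    using C1_curve_velocity[OF \<gamma> t c] .
  \<comment> \<open>The unweighted speed is the instance of \<open>speed_eq\<close> with weight
    \<open>1\<close>.\<close>
  have "g = conformal (\<lambda>_. 1) g" by (simp add: conformal_def)
  then show ?thesis
    using speed_eq[OF c C1_curve_near[OF \<gamma> t] v, of w] speed_eq[OF c C1_curve_near[OF \<gamma> t] v, of "\<lambda>_. 1"]
    by (simp add: real_sqrt_mult)
qed

section \<open>Local comparison of the metric and of differentials with Euclidean quantities\<close>

lemma openin_chart_preimage:
  assumes c: "c \<in> A" and V: "open V"
  shows "openin X {q \<in> chart_dom c. chart_map c q \<in> V}"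
proof -
  note ch = is_chartD[OF chart[OF c]]
  have "topspace (subtopology X (chart_dom c)) = chart_dom c"
    using openin_subset[OF ch(1)] by auto
  then have "openin (subtopology X (chart_dom c)) {q \<in> chart_dom c. chart_map c q \<in> V}"
    using openin_continuous_map_preimage[OF ch(8), of V] V by simp
  then show ?thesis using ch(1) openin_trans_full by blast
qed

text \<open>At \<open>x0\<close> the form has a positive minimum on the Euclidean unit sphere, which
  homogeneity turns into a bound for all vectors. The finitely many components are continuous, so
  near \<open>x0\<close> the form loses at most half of that minimum.\<close>

lemma metric_locally_bounded_below:
  assumes c: "c \<in> A" and x0: "x0 \<in> chart_image c"
  obtains m V where "0 < m" "open V" "x0 \<in> V"
    "\<And>x v. x \<in> chart_image c \<inter> V \<Longrightarrow> m * (norm v)\<^sup>2 \<le> g c (chart_inv c x) v v"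
proof -
  note ch = is_chartD[OF chart[OF c]]
  define G where "G x v = g c (chart_inv c x) v v" for x v
  define h where "h x b b' = g c (chart_inv c x) b b'" for x b b'
  have G: "G x v = (\<Sum>b\<in>Basis. \<Sum>b'\<in>Basis. (v \<bullet> b) * (v \<bullet> b') * h x b b')" if "x \<in> chart_image c" for x v
  proof -
    have "bilinear (g c (chart_inv c x))" using metric_at(1)[OF c ch(7)[OF that]] .
    then have "g c (chart_inv c x) (\<Sum>b\<in>Basis. (v \<bullet> b) *\<^sub>R b) (\<Sum>b\<in>Basis. (v \<bullet> b) *\<^sub>R b)
       = (\<Sum>b\<in>Basis. \<Sum>b'\<in>Basis. (v \<bullet> b) * (v \<bullet> b') * h x b b')"
      by (simp add: bilinear_sum sum.cartesian_product[symmetric] bilinear_lmul bilinear_rmul h_def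
          mult.assoc)
    then show ?thesis by (simp add: euclidean_representation G_def)
  qed
  have cG: "continuous_on (sphere 0 1) (G x0)"
    unfolding G[OF x0] by (intro continuous_intros)
  obtain b :: 'e where "b \<in> Basis" using nonempty_Basis by blast
  then have "sphere (0::'e) 1 \<noteq> {}" by (auto simp: norm_Basis intro!: exI[of _ b])
  then obtain v0 where v0: "v0 \<in> sphere 0 1" "\<And>v. v \<in> sphere 0 1 \<Longrightarrow> G x0 v0 \<le> G x0 v"
    using continuous_attains_inf[OF compact_sphere _ cG] by blast
  define m where "m = G x0 v0"
  have m: "0 < m" using metric_at(2)[OF c ch(7)[OF x0], of v0] v0(1) by (cases "v0 = 0") (auto simp: m_def G_def)
  have m_le: "m * (norm v)\<^sup>2 \<le> G x0 v" for v
  proof (cases "v = 0")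
    case True
    then show ?thesis using metric_nonneg[OF c ch(7)[OF x0]] by (simp add: G_def)
  next
    case False
    then have "m \<le> G x0 ((1 / norm v) *\<^sub>R v)" unfolding m_def by (intro v0(2)) auto
    also have "\<dots> = (1 / norm v)\<^sup>2 * G x0 v"
      unfolding G_def by (rule metric_scale[OF c ch(7)[OF x0]])
    finally show ?thesis using False by (simp add: field_simps)
  qed
  \<comment> \<open>The entrywise deviation from \<open>x0\<close>. Since each coordinate of
    \<open>v\<close> is at most \<open>norm v\<close>, the two quadratic forms differ by at most
    \<open>(norm v)\<^sup>2 * E x\<close>.\<close>
  define E where "E x = (\<Sum>b\<in>Basis. \<Sum>b'\<in>Basis. \<bar>h x b b' - h x0 b b'\<bar>)" for x
  have cE: "continuous_on (chart_image c) E"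
    unfolding E_def h_def
    by (intro continuous_intros smooth_within_continuous_on[OF metric_smooth[OF c]])
  have "openin (top_of_set (chart_image c)) (chart_image c \<inter> E -` {..<m/2})"
    by (rule continuous_openin_preimage_gen[OF cE]) auto
  then obtain V where V: "open V" "chart_image c \<inter> E -` {..<m/2} = chart_image c \<inter> V"
    by (auto simp: openin_open)
  have "x0 \<in> V" using V x0 m by (auto simp: E_def)
  moreover have "m / 2 * (norm v)\<^sup>2 \<le> G x v" if x: "x \<in> chart_image c \<inter> V" for x v
  proof -
    have "E x < m / 2" using V x by blast
    have "G x0 v - G x v = (\<Sum>b\<in>Basis. \<Sum>b'\<in>Basis. (v \<bullet> b) * (v \<bullet> b') * (h x0 b b' - h x b b'))"
      using x x0 by (simp add: G sum_subtractf right_diff_distrib)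
    also have "\<dots> \<le> (\<Sum>b\<in>Basis. \<Sum>b'\<in>Basis. (norm v)\<^sup>2 * \<bar>h x b b' - h x0 b b'\<bar>)"
    proof (intro sum_mono)
      fix b b' :: 'e assume "b \<in> Basis" "b' \<in> Basis"
      have "(v \<bullet> b) * (v \<bullet> b') * (h x0 b b' - h x b b') \<le> \<bar>v \<bullet> b\<bar> * \<bar>v \<bullet> b'\<bar> * \<bar>h x b b' - h x0 b b'\<bar>"
        by (metis abs_ge_self abs_minus_commute abs_mult)
      also have "\<dots> \<le> norm v * norm v * \<bar>h x b b' - h x0 b b'\<bar>"
        by (intro mult_right_mono mult_mono Basis_le_norm \<open>b \<in> Basis\<close> \<open>b' \<in> Basis\<close>) auto
      finally show "(v \<bullet> b) * (v \<bullet> b') * (h x0 b b' - h x b b') \<le> (norm v)\<^sup>2 * \<bar>h x b b' - h x0 b b'\<bar>"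
        by (simp add: power2_eq_square)
    qed
    also have "\<dots> = (norm v)\<^sup>2 * E x" by (simp add: E_def sum_distrib_left)
    also have "\<dots> \<le> (norm v)\<^sup>2 * (m / 2)" using \<open>E x < m / 2\<close> by (intro mult_left_mono) auto
    finally show ?thesis using m_le[of v] by (simp add: algebra_simps)
  qed
  ultimately show thesis using that[of "m/2" V] m V(1) by (simp add: G_def)
qed

text \<open>In one chart, the partial derivatives of a local extension of \<open>f\<close> are
  bounded by some \<open>K\<close> in total, and the metric dominates \<open>m\<close> times the
  square of the Euclidean norm; the quotient \<open>K / sqrt m\<close> is the constant. The bound
  concerns arbitrary curves through \<open>W\<close>, so that it can be transferred to the
  speed.\<close>

lemma gradient_locally_bounded:
  assumes f: "smooth_fun A f" and p: "p \<in> topspace X"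
  obtains c W C where "c \<in> A" "openin X W" "p \<in> W" "W \<subseteq> chart_dom c" "0 \<le> C"
    "\<And>\<gamma> t v d. \<gamma> t \<in> W \<Longrightarrow> eventually (\<lambda>s. \<gamma> s \<in> chart_dom c) (nhds t) \<Longrightarrow>
       ((chart_map c \<circ> \<gamma>) has_vector_derivative v) (at t) \<Longrightarrow>
       ((f \<circ> \<gamma>) has_vector_derivative d) (at t) \<Longrightarrow> \<bar>d\<bar> \<le> C * sqrt (g c (\<gamma> t) v v)"
proof -
  obtain c where c: "c \<in> A" "p \<in> chart_dom c" using ex_chart p by blast
  note ch = is_chartD[OF chart[OF c(1)]]
  define x0 where "x0 = chart_map c p"
  have x0: "x0 \<in> chart_image c" using ch(5) c by (simp add: x0_def)
  have sm: "smooth_within (f \<circ> chart_inv c) (chart_image c)"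
    using f c by (simp add: smooth_fun_def)
  obtain m V where m: "0 < m" and V: "open V" "x0 \<in> V"
    and mV: "\<And>x v. x \<in> chart_image c \<inter> V \<Longrightarrow> m * (norm v)\<^sup>2 \<le> g c (chart_inv c x) v v"
    using metric_locally_bounded_below[OF c(1) x0] by metis
  obtain U F where U: "open U" "x0 \<in> U" and dF: "\<And>y. y \<in> U \<Longrightarrow> F differentiable (at y)"
    and cF: "\<And>v. continuous_on U (\<lambda>y. frechet_derivative F (at y) v)"
    and F: "\<And>y. y \<in> chart_image c \<inter> U \<Longrightarrow> F y = f (chart_inv c y)"
    using smooth_withinE[OF sm x0] by (metis comp_apply)
  define M where "M y = (\<Sum>b\<in>Basis. \<bar>frechet_derivative F (at y) b\<bar>)" for y
  \<comment> \<open>The slack \<open>1\<close> makes \<open>M y < K\<close> an open condition that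
    holds at \<open>x0\<close>.\<close>
  define K where "K = M x0 + 1"
  have K: "0 \<le> K" by (simp add: K_def M_def sum_nonneg add_nonneg_nonneg)
  have cM: "continuous_on U M" unfolding M_def by (intro continuous_intros cF)
  have oM: "open (U \<inter> M -` {..<K})" by (rule continuous_open_preimage[OF cM U(1)]) auto
  define W where "W = {q \<in> chart_dom c. chart_map c q \<in> V \<inter> (U \<inter> M -` {..<K})}"
  have W: "openin X W" "p \<in> W" "W \<subseteq> chart_dom c"
    using openin_chart_preimage[OF c(1) open_Int[OF V(1) oM]] c V U
    by (auto simp: W_def x0_def[symmetric] K_def)
  have "\<bar>d\<bar> \<le> (K / sqrt m) * sqrt (g c (\<gamma> t) v v)"
    if \<gamma>: "\<gamma> t \<in> W" "eventually (\<lambda>s. \<gamma> s \<in> chart_dom c) (nhds t)"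
      and v: "((chart_map c \<circ> \<gamma>) has_vector_derivative v) (at t)"
      and d: "((f \<circ> \<gamma>) has_vector_derivative d) (at t)" for \<gamma> t v d
  proof -
    define y where "y = chart_map c (\<gamma> t)"
    have y: "y \<in> V" "y \<in> U" "M y < K" "y \<in> chart_image c" "chart_inv c y = \<gamma> t"
      using \<gamma>(1) ch by (auto simp: W_def y_def)
    have D: "(F has_derivative frechet_derivative F (at y)) (at y)"
      using dF y by (simp add: frechet_derivative_works[symmetric])
    have comp: "((F \<circ> (chart_map c \<circ> \<gamma>)) has_vector_derivative frechet_derivative F (at y) v) (at t)"
      using vector_derivative_diff_chain_within[OF v, of F "frechet_derivative F (at y)"] D
      by (simp add: has_derivative_at_withinI y_def)
    have "isCont (chart_map c \<circ> \<gamma>) t"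
      using v has_vector_derivative_continuous by blast
    then have "eventually (\<lambda>s. chart_map c (\<gamma> s) \<in> U) (nhds t)"
      using eventually_isCont_in_open[of t "chart_map c \<circ> \<gamma>" U] U y by (simp add: y_def)
    then have ev: "eventually (\<lambda>s. (F \<circ> (chart_map c \<circ> \<gamma>)) s = (f \<circ> \<gamma>) s) (nhds t)"
      using \<gamma>(2) by eventually_elim (use ch F in auto)
    then have "((f \<circ> \<gamma>) has_vector_derivative frechet_derivative F (at y) v) (at t)"
      using comp has_vector_derivative_cong_ev[of UNIV "F \<circ> (chart_map c \<circ> \<gamma>)" "f \<circ> \<gamma>" t]
        eventually_nhds_x_imp_x[OF ev] by auto
    then have "d = frechet_derivative F (at y) v" using d vector_derivative_unique_at by blast
    also have "\<dots> = (\<Sum>b\<in>Basis. (v \<bullet> b) * frechet_derivative F (at y) b)"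
      using frechet_derivative_sum_Basis[OF dF[OF y(2)], of v] by (simp only: real_scaleR_def)
    finally have "\<bar>d\<bar> \<le> (\<Sum>b\<in>Basis. \<bar>(v \<bullet> b) * frechet_derivative F (at y) b\<bar>)"
      by (simp add: sum_abs)
    also have "\<dots> \<le> (\<Sum>b\<in>Basis. norm v * \<bar>frechet_derivative F (at y) b\<bar>)"
      by (intro sum_mono) (simp add: abs_mult mult_right_mono Basis_le_norm)
    also have "\<dots> = norm v * M y" by (simp add: M_def sum_distrib_left)
    also have "\<dots> \<le> norm v * K" using y by (intro mult_left_mono) auto
    also have "\<dots> = (K / sqrt m) * sqrt (m * (norm v)\<^sup>2)"
      using m by (simp add: real_sqrt_mult)
    also have "\<dots> \<le> (K / sqrt m) * sqrt (g c (\<gamma> t) v v)"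
      using mV[of y v] y K m by (intro mult_left_mono real_sqrt_le_mono) auto
    finally show ?thesis .
  qed
  then show thesis
    using that[OF c(1) W, of "K / sqrt m"] K m by auto
qed

end

section \<open>Logarithmic lower bounds for the distance\<close>

text \<open>Additivity of the integral requires measurable integrands, and \<open>speed\<close> is
  not known to be one. The induction over the pieces therefore builds a measurable minorant
  \<open>h\<close> of the speed, made of the functions \<open>\<bar>\<phi>\<bar>\<close>, and only
  compares integrals by monotonicity at the end.\<close>

lemma curve_length_ge:
  assumes \<gamma>: "piecewise_C1_curve X A \<gamma>"
    and deriv: "\<And>a b. 0 \<le> a \<Longrightarrow> a < b \<Longrightarrow> b \<le> 1 \<Longrightarrow> C1_curve X A \<gamma> a b \<Longrightarrow>
      \<exists>\<phi>. continuous_on {a..b} \<phi> \<and>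
        (\<forall>t\<in>{a..b}. ((f \<circ> \<gamma>) has_vector_derivative \<phi> t) (at t within {a..b})) \<and>
        (\<forall>t. a < t \<longrightarrow> t < b \<longrightarrow> \<bar>\<phi> t\<bar> \<le> speed A g \<gamma> t)"
  shows "ennreal \<bar>f (\<gamma> 1) - f (\<gamma> 0)\<bar> \<le> curve_length A g \<gamma>"
proof -
  obtain m \<tau> where \<tau>: "\<tau> 0 = (0::real)" "\<tau> m = 1"
    and step: "\<And>k. k < m \<Longrightarrow> \<tau> k < \<tau> (Suc k)" "\<And>k. k < m \<Longrightarrow> C1_curve X A \<gamma> (\<tau> k) (\<tau> (Suc k))"
    using \<gamma> unfolding piecewise_C1_curve_def by metis
  have le1: "\<tau> k \<le> 1" if "k \<le> m" for k
    using that
  proof (induction rule: inc_induct)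
    case base then show ?case using \<tau> by simp
  next
    case (step k) then show ?case using \<open>\<And>k. k < m \<Longrightarrow> \<tau> k < \<tau> (Suc k)\<close>[of k] by simp
  qed
  have "0 \<le> \<tau> k \<and> (\<exists>h\<in>borel_measurable lborel.
      (\<forall>t. h t \<le> ennreal (speed A g \<gamma> t) * indicator {0..\<tau> k} t) \<and>
      (\<forall>t. t \<ge> \<tau> k \<longrightarrow> h t = 0) \<and>
      ennreal \<bar>f (\<gamma> (\<tau> k)) - f (\<gamma> 0)\<bar> \<le> integral\<^sup>N lborel h)" if "k \<le> m" for k
    using that
  proof (induction k)
    case 0
    show ?case by (auto simp: \<tau> intro!: bexI[of _ "\<lambda>_. 0"])
  next
    case (Suc k)
    then obtain h where h: "h \<in> borel_measurable lborel"
      "\<And>t. h t \<le> ennreal (speed A g \<gamma> t) * indicator {0..\<tau> k} t" "\<And>t. t \<ge> \<tau> k \<Longrightarrow> h t = 0"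
      "ennreal \<bar>f (\<gamma> (\<tau> k)) - f (\<gamma> 0)\<bar> \<le> integral\<^sup>N lborel h" and k0: "0 \<le> \<tau> k"
      by auto
    define a b where "a = \<tau> k" and "b = \<tau> (Suc k)"
    have ab: "0 \<le> a" "a < b" "b \<le> 1" "C1_curve X A \<gamma> a b"
      using Suc.prems step le1 k0 by (auto simp: a_def b_def)
    obtain \<phi> where \<phi>: "continuous_on {a..b} \<phi>"
        "\<And>t. t\<in>{a..b} \<Longrightarrow> ((f \<circ> \<gamma>) has_vector_derivative \<phi> t) (at t within {a..b})"
        "\<And>t. a < t \<Longrightarrow> t < b \<Longrightarrow> \<bar>\<phi> t\<bar> \<le> speed A g \<gamma> t"
      using deriv[OF ab] by auto
    \<comment> \<open>The open interval omits the breakpoints, where the speed is not controlled;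
      the two endpoints are null sets and do not change the integral.\<close>
    define h' where "h' t = ennreal (norm (indicator {a<..<b} t *\<^sub>R \<phi> t))" for t
    have mh': "h' \<in> borel_measurable lborel"
      unfolding h'_def using borel_measurable_continuous_on_indicator[of "{a<..<b}" \<phi>]
        continuous_on_subset[OF \<phi>(1)] by (auto simp: subset_iff)
    have FTC: "integrable lborel (\<lambda>t. indicator {a..b} t *\<^sub>R \<phi> t)"
      "(\<integral>t. indicator {a..b} t *\<^sub>R \<phi> t \<partial>lborel) = f (\<gamma> b) - f (\<gamma> a)"
      using has_bochner_integral_FTC_Icc[of a b "f \<circ> \<gamma>" \<phi>] \<phi>(1,2) ab
      by (auto simp: has_bochner_integral_iff)
    have "ennreal \<bar>f (\<gamma> b) - f (\<gamma> a)\<bar> \<le> (\<integral>\<^sup>+t. ennreal (norm (indicator {a..b} t *\<^sub>R \<phi> t)) \<partial>lborel)"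
      using integral_norm_bound_ennreal[OF FTC(1)] FTC(2) by simp
    also have "\<dots> = integral\<^sup>N lborel h'"
    proof (rule nn_integral_cong_AE)
      show "AE t in lborel. ennreal (norm (indicator {a..b} t *\<^sub>R \<phi> t)) = h' t"
        using AE_lborel_singleton[of a] AE_lborel_singleton[of b]
        by eventually_elim (auto simp: h'_def indicator_def)
    qed
    finally have h'int: "ennreal \<bar>f (\<gamma> b) - f (\<gamma> a)\<bar> \<le> integral\<^sup>N lborel h'" .
    have "ennreal \<bar>f (\<gamma> b) - f (\<gamma> 0)\<bar> \<le> ennreal (\<bar>f (\<gamma> a) - f (\<gamma> 0)\<bar> + \<bar>f (\<gamma> b) - f (\<gamma> a)\<bar>)"
      by (intro ennreal_leI) auto
    also have "\<dots> \<le> integral\<^sup>N lborel h + integral\<^sup>N lborel h'"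
      using h(4) h'int by (auto simp: a_def ennreal_plus intro: add_mono)
    also have "\<dots> = integral\<^sup>N lborel (\<lambda>t. h t + h' t)"
      by (rule nn_integral_add[symmetric]) (use h mh' in auto)
    finally have 1: "ennreal \<bar>f (\<gamma> b) - f (\<gamma> 0)\<bar> \<le> integral\<^sup>N lborel (\<lambda>t. h t + h' t)" .
    \<comment> \<open>The supports are disjoint: \<open>h\<close> vanishes from \<open>a\<close> on,
      and \<open>h'\<close> vanishes up to \<open>a\<close>. So the sum is still below the
      speed.\<close>
    have 2: "h t + h' t \<le> ennreal (speed A g \<gamma> t) * indicator {0..b} t" for t
    proof (cases "t < a \<or> t = a")
      case True
      then show ?thesis using h(2)[of t] ab by (auto simp: h'_def indicator_def a_def split: if_splits)
    next
      case False
      then have "h t = 0" using h(3) by (simp add: a_def)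
      then show ?thesis using \<phi>(3)[of t] False ab
        by (auto simp: h'_def indicator_def intro!: ennreal_leI)
    qed
    have 3: "h t + h' t = 0" if "t \<ge> b" for t
      using that h(3)[of t] ab by (auto simp: a_def h'_def)
    show ?case
      using ab h(1) mh' 1 2 3 unfolding b_def[symmetric] by (auto intro!: bexI[of _ "\<lambda>t. h t + h' t"])
  qed
  from this[of m] obtain h where h: "\<And>t. h t \<le> ennreal (speed A g \<gamma> t) * indicator {0..1} t"
    "ennreal \<bar>f (\<gamma> 1) - f (\<gamma> 0)\<bar> \<le> integral\<^sup>N lborel h"
    by (auto simp: \<tau>)
  note h(2)
  also have "integral\<^sup>N lborel h \<le> curve_length A g \<gamma>"
    unfolding curve_length_def by (intro nn_integral_mono h(1))
  finally show ?thesis .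
qed

context riemannian_corner_manifold
begin

text \<open>A curve may cross many charts, so the continuous derivative is obtained chart by chart
  and glued.\<close>

lemma smooth_fun_along_curve:
  assumes f: "smooth_fun A f" and ab: "a < b" and \<gamma>: "C1_curve X A \<gamma> a b"
  obtains \<phi> where "continuous_on {a..b} \<phi>"
    "\<And>t. t \<in> {a..b} \<Longrightarrow> ((f \<circ> \<gamma>) has_vector_derivative \<phi> t) (at t within {a..b})"
proof (rule vector_derivative_patch[OF ab subset_refl])
  fix t0 assume t0: "t0 \<in> {a..b}"
  then obtain c where c: "c \<in> A" "\<gamma> t0 \<in> chart_dom c"
    using ex_chart C1_curve_in[OF \<gamma>] by blast
  note ch = is_chartD[OF chart[OF c(1)]]
  define N where "N = {s \<in> {a..b}. \<gamma> s \<in> chart_dom c}"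
  have N: "openin (top_of_set {a..b}) N"
    using openin_continuous_map_preimage[OF _ ch(1), of "top_of_set {a..b}" \<gamma>] \<gamma>
    by (simp add: C1_curve_def N_def)
  obtain D where D: "continuous_on N D"
    "\<And>t. t \<in> N \<Longrightarrow> ((chart_map c \<circ> \<gamma>) has_vector_derivative D t) (at t within {a..b})"
    using \<gamma> c(1) unfolding C1_curve_def N_def by blast
  have sm: "smooth_within (f \<circ> chart_inv c) (chart_image c)"
    using f c by (simp add: smooth_fun_def)
  obtain d where "continuous_on N d"
    "\<And>t. t \<in> N \<Longrightarrow> ((f \<circ> \<gamma>) has_vector_derivative d t) (at t within {a..b})"
    by (rule smooth_curve[OF sm ab N, of "chart_map c \<circ> \<gamma>" "f \<circ> \<gamma>" D])
      (use D ch in \<open>auto simp: N_def\<close>)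
  then show "\<exists>N d. openin (top_of_set {a..b}) N \<and> t0 \<in> N \<and> N \<subseteq> {a..b} \<and>
      continuous_on N d \<and> (\<forall>t\<in>N. ((f \<circ> \<gamma>) has_vector_derivative d t) (at t within {a..b}))"
    using N t0 c by (intro exI[of _ N] exI[of _ d]) (auto simp: N_def)
qed (use that in auto)

text \<open>An infinitesimal Lipschitz condition. The continuous derivative is part of it so that
  the fundamental theorem of calculus applies to \<open>f\<close> and to functions of
  \<open>f\<close>; the bound is imposed at interior parameters only, where the speed is
  determined.\<close>

definition lipschitz_along :: "('x \<Rightarrow> real) \<Rightarrow> real \<Rightarrow> bool" where
  "lipschitz_along f C \<longleftrightarrow>
     (\<forall>\<gamma> a b. a < b \<longrightarrow> C1_curve X A \<gamma> a b \<longrightarrow>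
        (\<exists>\<phi>. continuous_on {a..b} \<phi> \<and>
           (\<forall>t\<in>{a..b}. ((f \<circ> \<gamma>) has_vector_derivative \<phi> t) (at t within {a..b})) \<and>
           (\<forall>t. a < t \<longrightarrow> t < b \<longrightarrow> \<bar>\<phi> t\<bar> \<le> C * speed A g \<gamma> t)))"

text \<open>The compact space contains its boundary, so finitely many neighbourhoods with a local
  gradient bound cover it and the constant does not degenerate at the faces.\<close>

lemma smooth_fun_lipschitz_along:
  assumes X: "compact_space X" and f: "smooth_fun A f"
  obtains C where "0 < C" "lipschitz_along f C"
proof -
  \<comment> \<open>Stated with \<open>speed\<close> instead of a chart, so that a neighbourhood can
    be used without remembering the chart it came from.\<close>
  define P where "P W C \<longleftrightarrow> openin X W \<and> 0 \<le> C \<and>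
     (\<forall>\<gamma> a b t d. a < t \<longrightarrow> t < b \<longrightarrow> C1_curve X A \<gamma> a b \<longrightarrow> \<gamma> t \<in> W \<longrightarrow>
        ((f \<circ> \<gamma>) has_vector_derivative d) (at t) \<longrightarrow> \<bar>d\<bar> \<le> C * speed A g \<gamma> t)" for W C
  have loc: "\<exists>W C. P W C \<and> p \<in> W" if p: "p \<in> topspace X" for p
  proof -
    obtain c W C where c: "c \<in> A" and W: "openin X W" "p \<in> W" "W \<subseteq> chart_dom c" and C: "0 \<le> C"
      and bd: "\<And>\<gamma> t v d. \<gamma> t \<in> W \<Longrightarrow> eventually (\<lambda>s. \<gamma> s \<in> chart_dom c) (nhds t) \<Longrightarrow>
       ((chart_map c \<circ> \<gamma>) has_vector_derivative v) (at t) \<Longrightarrow>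
       ((f \<circ> \<gamma>) has_vector_derivative d) (at t) \<Longrightarrow> \<bar>d\<bar> \<le> C * sqrt (g c (\<gamma> t) v v)"
      using gradient_locally_bounded[OF f p] by metis
    have "\<bar>d\<bar> \<le> C * speed A g \<gamma> t"
      if t: "a < t" "t < b" and \<gamma>: "C1_curve X A \<gamma> a b" "\<gamma> t \<in> W"
        and d: "((f \<circ> \<gamma>) has_vector_derivative d) (at t)" for \<gamma> a b t d
    proof -
      have tc: "\<gamma> t \<in> chart_dom c" using \<gamma> W by auto
      obtain v where v: "((chart_map c \<circ> \<gamma>) has_vector_derivative v) (at t)"
        using C1_curve_velocity[OF \<gamma>(1) t c tc] .
      have "speed A g \<gamma> t = sqrt (g c (\<gamma> t) v v)"
        using speed_eq[OF c tc C1_curve_near[OF \<gamma>(1) t] v, of "\<lambda>_. 1"] by (simp add: conformal_def)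
      with bd[OF \<gamma>(2) C1_curve_near[OF \<gamma>(1) t c tc] v d] show ?thesis by simp
    qed
    note speed_bound = this
    have "P W C"
      unfolding P_def by (intro conjI allI impI W C) (rule speed_bound)
    with W(2) show ?thesis by blast
  qed
  define \<U> where "\<U> = {W. \<exists>C. P W C}"
  have "openin X U" if "U \<in> \<U>" for U using that by (auto simp: \<U>_def P_def)
  moreover have "topspace X \<subseteq> \<Union>\<U>"
  proof
    fix p assume "p \<in> topspace X"
    from loc[OF this] show "p \<in> \<Union>\<U>" unfolding \<U>_def by blast
  qed
  ultimately obtain \<F> where \<F>: "finite \<F>" "\<F> \<subseteq> \<U>" "topspace X \<subseteq> \<Union>\<F>"
    using compactinD[of X "topspace X" \<U>] X unfolding compact_space_def by meson
  define K where "K W = (SOME C. P W C)" for W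
  have K: "P W (K W)" if "W \<in> \<F>" for W
  proof -
    have "\<exists>C. P W C" using subsetD[OF \<F>(2) that] by (simp add: \<U>_def)
    then show ?thesis unfolding K_def by (rule someI_ex[of "P W"])
  qed
  \<comment> \<open>The sum dominates each local constant; the \<open>1\<close> makes it strictly
    positive even if all of them are zero or the cover is empty.\<close>
  define C where "C = (\<Sum>W\<in>\<F>. K W) + 1"
  have K0: "0 \<le> K W" if "W \<in> \<F>" for W
    using K[OF that] unfolding P_def by (elim conjE)
  have KC: "K W \<le> C" if "W \<in> \<F>" for W
  proof -
    have "K W \<le> (\<Sum>W\<in>\<F>. K W)"
      by (rule member_le_sum[OF that]) (use K0 \<F>(1) in auto)
    then show ?thesis by (simp add: C_def)
  qed
  have "0 \<le> (\<Sum>W\<in>\<F>. K W)" using K0 by (intro sum_nonneg)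
  then have "0 < C" unfolding C_def by simp
  moreover have "lipschitz_along f C"
    unfolding lipschitz_along_def
  proof (intro allI impI)
    fix \<gamma> and a b :: real assume ab: "a < b" and \<gamma>: "C1_curve X A \<gamma> a b"
    obtain \<phi> where \<phi>: "continuous_on {a..b} \<phi>"
      "\<And>t. t \<in> {a..b} \<Longrightarrow> ((f \<circ> \<gamma>) has_vector_derivative \<phi> t) (at t within {a..b})"
      using smooth_fun_along_curve[OF f ab \<gamma>] by metis
    have "\<bar>\<phi> t\<bar> \<le> C * speed A g \<gamma> t" if t: "a < t" "t < b" for t
    proof -
      obtain W where W: "W \<in> \<F>" "\<gamma> t \<in> W" using C1_curve_in[OF \<gamma>, of t] t \<F>(3) by auto
      have "((f \<circ> \<gamma>) has_vector_derivative \<phi> t) (at t)"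
        using \<phi>(2)[of t] t by (simp add: at_within_Icc_at)
      then have "\<bar>\<phi> t\<bar> \<le> K W * speed A g \<gamma> t" using K[OF W(1)] t \<gamma> W(2) unfolding P_def by blast
      also have "\<dots> \<le> C * speed A g \<gamma> t"
      \<comment> \<open>Enlarging the constant requires a nonnegative speed, which is read off from
        its value in a chart.\<close>
      proof (intro mult_right_mono KC[OF W(1)])
        have "\<gamma> t \<in> topspace X" using C1_curve_in[OF \<gamma>, of t] t by auto
        then obtain c where c: "c \<in> A" "\<gamma> t \<in> chart_dom c" using ex_chart by blast
        obtain v where v: "((chart_map c \<circ> \<gamma>) has_vector_derivative v) (at t)"
          using C1_curve_velocity[OF \<gamma> t c] .
        show "0 \<le> speed A g \<gamma> t"
          using speed_eq[OF c C1_curve_near[OF \<gamma> t] v, of "\<lambda>_. 1"] metric_nonneg[OF c, of v] by (simp add: conformal_def)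
      qed
      finally show ?thesis .
    qed
    with \<phi> show "\<exists>\<phi>. continuous_on {a..b} \<phi> \<and>
        (\<forall>t\<in>{a..b}. ((f \<circ> \<gamma>) has_vector_derivative \<phi> t) (at t within {a..b})) \<and>
        (\<forall>t. a < t \<longrightarrow> t < b \<longrightarrow> \<bar>\<phi> t\<bar> \<le> C * speed A g \<gamma> t)" by blast
  qed
  ultimately show thesis using that by blast
qed

lemma lipschitz_along_sum:
  assumes "finite I" "\<And>i. i \<in> I \<Longrightarrow> lipschitz_along (f i) (C i)"
  shows "lipschitz_along (\<lambda>q. \<Sum>i\<in>I. f i q) (\<Sum>i\<in>I. C i)"
  unfolding lipschitz_along_def
proof (intro allI impI)
  fix \<gamma> and a b :: real assume ab: "a < b" and \<gamma>: "C1_curve X A \<gamma> a b"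
  have "\<forall>i\<in>I. \<exists>\<phi>. continuous_on {a..b} \<phi> \<and>
           (\<forall>t\<in>{a..b}. ((f i \<circ> \<gamma>) has_vector_derivative \<phi> t) (at t within {a..b})) \<and>
           (\<forall>t. a < t \<longrightarrow> t < b \<longrightarrow> \<bar>\<phi> t\<bar> \<le> C i * speed A g \<gamma> t)"
    using assms(2) ab \<gamma> unfolding lipschitz_along_def by blast
  then obtain \<phi> where \<phi>: "\<And>i. i \<in> I \<Longrightarrow> continuous_on {a..b} (\<phi> i)"
    "\<And>i t. i \<in> I \<Longrightarrow> t\<in>{a..b} \<Longrightarrow> ((f i \<circ> \<gamma>) has_vector_derivative \<phi> i t) (at t within {a..b})"
    "\<And>i t. i \<in> I \<Longrightarrow> a < t \<Longrightarrow> t < b \<Longrightarrow> \<bar>\<phi> i t\<bar> \<le> C i * speed A g \<gamma> t"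
    by metis
  have "((\<lambda>q. \<Sum>i\<in>I. f i q) \<circ> \<gamma>) = (\<lambda>s. \<Sum>i\<in>I. (f i \<circ> \<gamma>) s)" by (simp add: fun_eq_iff)
  moreover have "\<bar>\<Sum>i\<in>I. \<phi> i t\<bar> \<le> (\<Sum>i\<in>I. C i) * speed A g \<gamma> t" if "a < t" "t < b" for t
    unfolding sum_distrib_right
    using that \<phi>(3) by (intro order_trans[OF sum_abs] sum_mono) auto
  ultimately show "\<exists>\<phi>. continuous_on {a..b} \<phi> \<and>
      (\<forall>t\<in>{a..b}. (((\<lambda>q. \<Sum>i\<in>I. f i q) \<circ> \<gamma>) has_vector_derivative \<phi> t) (at t within {a..b})) \<and>
      (\<forall>t. a < t \<longrightarrow> t < b \<longrightarrow> \<bar>\<phi> t\<bar> \<le> (\<Sum>i\<in>I. C i) * speed A g \<gamma> t)"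
    using \<phi>(1) \<phi>(2)[unfolded o_def] by (intro exI[of _ "\<lambda>t. \<Sum>i\<in>I. \<phi> i t"])
      (auto simp: o_def intro!: continuous_on_sum has_vector_derivative_sum)
qed

text \<open>With \<open>k = sqrt \<kappa> / C\<close>, the derivative of \<open>k * ln R\<close>
  along a curve is in absolute value at most \<open>sqrt (\<kappa> / R\<^sup>2)\<close> times the
  unweighted speed, hence at most the weighted speed. So \<open>k * ln R\<close> is 1-Lipschitz,
  with no restriction on where in the interior the curve runs.\<close>

lemma riem_dist_ge_ln:
  assumes R: "lipschitz_along R C" and C: "0 < C" and \<kappa>: "0 < \<kappa>"
    and pos: "\<And>q. q \<in> mfd_interior X A \<Longrightarrow> 0 < R q"
    and w: "\<And>q. q \<in> mfd_interior X A \<Longrightarrow> \<kappa> / (R q)\<^sup>2 \<le> w q"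
  shows "ennreal (sqrt \<kappa> / C * \<bar>ln (R q) - ln (R p)\<bar>) \<le> riem_dist X A (conformal w g) p q"
  unfolding riem_dist_def
proof (rule INF_greatest)
  fix \<gamma> assume "\<gamma> \<in> {\<gamma>. piecewise_C1_curve X A \<gamma> \<and> \<gamma> ` {0..1} \<subseteq> mfd_interior X A \<and> \<gamma> 0 = p \<and> \<gamma> 1 = q}"
  then have \<gamma>: "piecewise_C1_curve X A \<gamma>" and int: "\<gamma> ` {0..1} \<subseteq> mfd_interior X A"
    and ends: "\<gamma> 0 = p" "\<gamma> 1 = q" by auto
  define k where "k = sqrt \<kappa> / C"
  have k: "0 < k" using C \<kappa> by (simp add: k_def)
  have "ennreal \<bar>k * ln (R (\<gamma> 1)) - k * ln (R (\<gamma> 0))\<bar> \<le> curve_length A (conformal w g) \<gamma>"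
  proof (rule curve_length_ge[OF \<gamma>, where f = "\<lambda>q. k * ln (R q)"])
    fix a b :: real assume ab: "0 \<le> a" "a < b" "b \<le> 1" and \<gamma>ab: "C1_curve X A \<gamma> a b"
    obtain \<phi> where \<phi>: "continuous_on {a..b} \<phi>"
        "\<And>t. t\<in>{a..b} \<Longrightarrow> ((R \<circ> \<gamma>) has_vector_derivative \<phi> t) (at t within {a..b})"
        "\<And>t. a < t \<Longrightarrow> t < b \<Longrightarrow> \<bar>\<phi> t\<bar> \<le> C * speed A g \<gamma> t"
      using R ab(2) \<gamma>ab unfolding lipschitz_along_def by blast
    have Rpos: "0 < R (\<gamma> t)" if "t \<in> {a..b}" for t
      using int ab that by (intro pos) auto
    have cR: "continuous_on {a..b} (R \<circ> \<gamma>)"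
      unfolding continuous_on_eq_continuous_within
      using \<phi>(2) has_vector_derivative_continuous by blast
    have "continuous_on {a..b} (\<lambda>t. k * (\<phi> t / (R \<circ> \<gamma>) t))"
      using Rpos by (intro continuous_intros \<phi> cR) (auto simp: less_imp_neq[symmetric] dest: less_imp_neq)
    moreover have "(((\<lambda>q. k * ln (R q)) \<circ> \<gamma>) has_vector_derivative k * (\<phi> t / (R \<circ> \<gamma>) t)) (at t within {a..b})"
      if t: "t \<in> {a..b}" for t
    proof -
      have "((\<lambda>s. R (\<gamma> s)) has_field_derivative \<phi> t) (at t within {a..b})"
        using \<phi>(2)[OF t] by (simp add: has_real_derivative_iff_has_vector_derivative o_def)
      then have "((\<lambda>s. k * ln (R (\<gamma> s))) has_field_derivative k * (\<phi> t / (R \<circ> \<gamma>) t)) (at t within {a..b})"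
        by (auto intro!: derivative_eq_intros simp: Rpos[OF t])
      then show ?thesis by (simp add: has_real_derivative_iff_has_vector_derivative o_def)
    qed
    moreover have "\<bar>k * (\<phi> t / (R \<circ> \<gamma>) t)\<bar> \<le> speed A (conformal w g) \<gamma> t" if t: "a < t" "t < b" for t
    proof -
      define r where "r = R (\<gamma> t)"
      have r: "0 < r" using Rpos t by (simp add: r_def)
      \<comment> \<open>The sign of the speed follows from its being an upper bound, up to
        \<open>C > 0\<close>, of an absolute value.\<close>
      have s: "0 \<le> speed A g \<gamma> t"
        using order_trans[OF abs_ge_zero \<phi>(3)[OF t]] C by (simp add: zero_le_mult_iff)
      have "\<bar>k * (\<phi> t / (R \<circ> \<gamma>) t)\<bar> = k / r * \<bar>\<phi> t\<bar>" using k r by (simp add: r_def abs_mult)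
      also have "\<dots> \<le> k / r * (C * speed A g \<gamma> t)"
        using k r \<phi>(3)[OF t] by (intro mult_left_mono) auto
      also have "\<dots> = sqrt (\<kappa> / r\<^sup>2) * speed A g \<gamma> t"
        using C r by (simp add: k_def real_sqrt_divide)
      also have "\<dots> \<le> sqrt (w (\<gamma> t)) * speed A g \<gamma> t"
        unfolding r_def using s by (intro mult_right_mono real_sqrt_le_mono w subsetD[OF int] imageI) (use ab t in auto)
      finally show ?thesis using speed_conformal[OF \<gamma>ab t] by simp
    qed
    ultimately show "\<exists>\<phi>. continuous_on {a..b} \<phi> \<and>
        (\<forall>t\<in>{a..b}. (((\<lambda>q. k * ln (R q)) \<circ> \<gamma>) has_vector_derivative \<phi> t) (at t within {a..b})) \<and>
        (\<forall>t. a < t \<longrightarrow> t < b \<longrightarrow> \<bar>\<phi> t\<bar> \<le> speed A (conformal w g) \<gamma> t)" by blast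
  qed
  moreover have "\<bar>k * ln (R (\<gamma> 1)) - k * ln (R (\<gamma> 0))\<bar> = k * \<bar>ln (R (\<gamma> 1)) - ln (R (\<gamma> 0))\<bar>"
    using k by (simp add: abs_mult right_diff_distrib[symmetric])
  ultimately show "ennreal (sqrt \<kappa> / C * \<bar>ln (R q) - ln (R p)\<bar>) \<le> curve_length A (conformal w g) \<gamma>"
    by (simp add: k_def ends)
qed

lemma smooth_fun_continuous:
  assumes f: "smooth_fun A f"
  shows "continuous_map X euclideanreal f"
proof (rule pasting_lemma[where I = A and T = chart_dom and f = "\<lambda>_. f"])
  fix c assume c: "c \<in> A"
  note ch = is_chartD[OF chart[OF c]]
  show "openin X (chart_dom c)" by (rule ch(1))
  have "continuous_map (subtopology X (chart_dom c)) (top_of_set (chart_image c)) (chart_map c)"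
    using ch(5,8) by (auto simp: continuous_map_in_subtopology)
  moreover have "continuous_map (top_of_set (chart_image c)) euclideanreal (f \<circ> chart_inv c)"
    using smooth_within_continuous_on[of "f \<circ> chart_inv c" "chart_image c"] f c
    by (simp add: smooth_fun_def)
  ultimately have "continuous_map (subtopology X (chart_dom c)) euclideanreal (f \<circ> chart_inv c \<circ> chart_map c)"
    by (rule continuous_map_compose)
  then show "continuous_map (subtopology X (chart_dom c)) euclideanreal f"
    by (rule continuous_map_eq) (simp add: ch)
qed (use ex_chart in auto)

lemma not_accessible_point:
  assumes R: "lipschitz_along R C" "continuous_map X euclideanreal R" and C: "0 < C" and \<kappa>: "0 < \<kappa>"
    and pos: "\<And>q. q \<in> mfd_interior X A \<Longrightarrow> 0 < R q"
    and w: "\<And>q. q \<in> mfd_interior X A \<Longrightarrow> \<kappa> / (R q)\<^sup>2 \<le> w q"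
    and p: "R p = 0"
  shows "\<not> accessible_point X A (conformal w g) p"
proof
  assume "accessible_point X A (conformal w g) p"
  then obtain s where s: "\<And>n. s n \<in> mfd_interior X A"
    and cauchy: "\<And>\<epsilon>. \<epsilon> > 0 \<Longrightarrow> \<exists>M::nat. \<forall>m\<ge>M. \<forall>n\<ge>M. riem_dist X A (conformal w g) (s m) (s n) < \<epsilon>"
    and lim: "limitin X s p sequentially"
    unfolding accessible_point_def by blast
  define k where "k = sqrt \<kappa> / C"
  have k: "0 < k" using C \<kappa> by (simp add: k_def)
  \<comment> \<open>One tolerance is enough: staying within distance \<open>1\<close> of
    \<open>s M\<close> confines \<open>ln R\<close> to within \<open>1 / k\<close> of its value
    there.\<close>
  obtain M where M: "\<And>n. n \<ge> M \<Longrightarrow> riem_dist X A (conformal w g) (s M) (s n) < 1"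
    using cauchy[of 1] by auto
  have bd: "ln (R (s M)) - 1 / k \<le> ln (R (s n))" if "n \<ge> M" for n
  proof -
    have "ennreal (k * \<bar>ln (R (s n)) - ln (R (s M))\<bar>) < 1"
      using le_less_trans[OF riem_dist_ge_ln[OF R(1) C \<kappa> pos w] M[OF that]] by (simp add: k_def)
    then have "k * \<bar>ln (R (s n)) - ln (R (s M))\<bar> < 1" by (simp add: ennreal_less_one_iff)
    then have "\<bar>ln (R (s n)) - ln (R (s M))\<bar> < 1 / k" using k by (simp add: field_simps)
    then show ?thesis by linarith
  qed
  have "limitin euclideanreal (R \<circ> s) (R p) sequentially"
    by (rule continuous_map_limit[OF R(2) lim])
  then have "(\<lambda>n. R (s n)) \<longlonglongrightarrow> 0" using p by (simp add: o_def)
  \<comment> \<open>Positivity of \<open>R\<close> in the interior upgrades convergence to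
    \<open>0\<close> to convergence from the right, where the logarithm diverges.\<close>
  then have "filterlim (\<lambda>n. R (s n)) (at_right 0) sequentially"
    using pos[OF s] by (auto simp: filterlim_at less_imp_neq[symmetric])
  then have "filterlim (\<lambda>n. ln (R (s n))) at_bot sequentially"
    by (rule filterlim_compose[OF ln_at_0])
  then have "eventually (\<lambda>n. ln (R (s n)) < ln (R (s M)) - 1 / k) sequentially"
    by (simp add: filterlim_at_bot_dense)
  then obtain M' where "\<And>n. n \<ge> M' \<Longrightarrow> ln (R (s n)) < ln (R (s M)) - 1 / k"
    by (auto simp: eventually_sequentially)
  from this[of "max M M'"] bd[of "max M M'"] show False by simp
qed

end

section \<open>Rays leaving a corner\<close>

text \<open>The derivative is known only within \<open>S\<close>, so the chain rule is applied on a
  short closed segment of the ray that lies in \<open>S\<close>; this gives the one-sided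
  directional derivative.\<close>

lemma has_derivative_ray:
  fixes f :: "'a::real_normed_vector \<Rightarrow> real"
  assumes f: "(f has_derivative D) (at x0 within S)" and x0: "x0 \<in> S"
    and ev: "eventually (\<lambda>t. x0 + t *\<^sub>R u \<in> S) (at_right (0::real))"
  shows "((\<lambda>t. (f (x0 + t *\<^sub>R u) - f x0) / t) \<longlongrightarrow> D u) (at_right 0)"
proof -
  obtain \<delta> where \<delta>: "\<delta> > 0" "\<And>t. 0 < t \<Longrightarrow> t < \<delta> \<Longrightarrow> x0 + t *\<^sub>R u \<in> S"
    using ev by (auto simp: eventually_at_right_field)
  \<comment> \<open>Halving keeps the right endpoint inside the range where the ray is known to lie
    in \<open>S\<close>.\<close>
  define J where "J = {0..\<delta>/2}"
  define h where "h t = x0 + t *\<^sub>R u" for t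
  have hJ: "h ` J \<subseteq> S"
  proof (rule image_subsetI)
    fix t assume "t \<in> J"
    then have "t = 0 \<or> (0 < t \<and> t < \<delta>)" using \<delta>(1) by (auto simp: J_def)
    then show "h t \<in> S" using \<delta>(2) x0 by (auto simp: h_def)
  qed
  have "(h has_vector_derivative u) (at 0 within J)"
    unfolding h_def by (auto intro!: derivative_eq_intros)
  then have "((f \<circ> h) has_vector_derivative D u) (at 0 within J)"
    by (rule vector_derivative_diff_chain_within)
      (use f hJ in \<open>auto simp: h_def intro: has_derivative_subset\<close>)
  then have "((\<lambda>t. (f (h t) - f (h 0)) / (t - 0)) \<longlongrightarrow> D u) (at 0 within J)"
    by (simp add: has_real_derivative_iff_has_vector_derivative[symmetric] has_field_derivative_iff)
  moreover have "at 0 within J = at_right 0" using \<delta>(1) by (simp add: J_def at_within_Icc_at_right)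
  ultimately show ?thesis by (simp add: h_def)
qed

lemma boundary_definingD:
  assumes "boundary_defining X A H \<rho>"
  shows "q \<in> H \<Longrightarrow> \<rho> q = 0" and "q \<in> topspace X \<Longrightarrow> q \<notin> H \<Longrightarrow> 0 < \<rho> q"
    and "q \<in> topspace X \<Longrightarrow> 0 \<le> \<rho> q" and "smooth_fun A \<rho>"
proof -
  have *: "smooth_fun A \<rho>" "H = {p \<in> topspace X. \<rho> p = 0}" "\<forall>p\<in>topspace X - H. 0 < \<rho> p"
    using assms by (simp_all add: boundary_defining_def)
  show H: "q \<in> H \<Longrightarrow> \<rho> q = 0" using *(2) by blast
  show pos: "q \<in> topspace X \<Longrightarrow> q \<notin> H \<Longrightarrow> 0 < \<rho> q" using *(3) by blast
  show "q \<in> topspace X \<Longrightarrow> 0 \<le> \<rho> q" using H pos by (cases "q \<in> H") (auto intro: less_imp_le)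
  show "smooth_fun A \<rho>" by (rule *(1))
qed

context riemannian_corner_manifold
begin

text \<open>Vanishing corner coordinates do not decrease along the ray, positive ones stay positive
  for a short time, and there are finitely many of them. Relative openness of the image supplies the
  rest.\<close>

lemma ray_in_chart_image:
  assumes c: "c \<in> A" and x0: "x0 \<in> chart_image c"
    and u: "\<And>b. b \<in> chart_corner c \<Longrightarrow> x0 \<bullet> b = 0 \<Longrightarrow> 0 \<le> u \<bullet> b"
  shows "eventually (\<lambda>t. x0 + t *\<^sub>R u \<in> chart_image c) (at_right (0::real))"
proof -
  note ch = is_chartD[OF chart[OF c]]
  obtain V where V: "open V" "chart_image c = corner_model (chart_corner c) \<inter> V"
    using ch(3) unfolding openin_open by blast
  have lim: "((\<lambda>t. x0 + t *\<^sub>R u) \<longlongrightarrow> x0) (at_right 0)"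
    by (auto intro!: tendsto_eq_intros)
  have fin: "finite (chart_corner c)" using ch(2) finite_Basis finite_subset by blast
  have "eventually (\<lambda>t. x0 + t *\<^sub>R u \<in> V) (at_right 0)"
    using topological_tendstoD[OF lim V(1)] x0 V(2) by blast
  moreover have "eventually (\<lambda>t. \<forall>b\<in>chart_corner c. 0 \<le> (x0 + t *\<^sub>R u) \<bullet> b) (at_right 0)"
  proof (rule eventually_ball_finite[OF fin], rule ballI)
    fix b assume b: "b \<in> chart_corner c"
    have "0 \<le> x0 \<bullet> b" using x0 V(2) b by (auto simp: corner_model_def)
    then consider "x0 \<bullet> b = 0" | "0 < x0 \<bullet> b" by linarith
    then show "eventually (\<lambda>t. 0 \<le> (x0 + t *\<^sub>R u) \<bullet> b) (at_right 0)"
    proof cases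
      case 1
      have "eventually (\<lambda>t::real. 0 < t) (at_right 0)" by (simp add: eventually_at_right_less)
      then show ?thesis
        by eventually_elim (use 1 u[OF b 1] in \<open>simp add: inner_add_left\<close>)
    next
      case 2
      have "((\<lambda>t. (x0 + t *\<^sub>R u) \<bullet> b) \<longlongrightarrow> x0 \<bullet> b) (at_right 0)"
        by (intro tendsto_intros lim)
      from order_tendstoD(1)[OF this 2] show ?thesis by eventually_elim simp
    qed
  qed
  ultimately show ?thesis
    by eventually_elim (use V(2) in \<open>auto simp: corner_model_def\<close>)
qed

text \<open>Every active coordinate grows at unit rate and no other corner coordinate changes, so
  the ray enters the interior at once. At an interior point the sum is empty and the ray is
  constant.\<close>

definition inward :: "('x, 'e) chart \<Rightarrow> 'x \<Rightarrow> 'e" where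
  "inward c p = \<Sum>{b \<in> chart_corner c. chart_map c p \<bullet> b = 0}"

definition inward_ray :: "('x, 'e) chart \<Rightarrow> 'x \<Rightarrow> real \<Rightarrow> 'x" where
  "inward_ray c p t = chart_inv c (chart_map c p + t *\<^sub>R inward c p)"

lemma inner_inward:
  assumes c: "c \<in> A" and b: "b \<in> chart_corner c"
  shows "inward c p \<bullet> b = (if chart_map c p \<bullet> b = 0 then 1 else 0)"
proof -
  note ch = is_chartD[OF chart[OF c]]
  have fin: "finite (chart_corner c)" using ch(2) finite_Basis finite_subset by blast
  have "inward c p \<bullet> b = (\<Sum>b'\<in>{b \<in> chart_corner c. chart_map c p \<bullet> b = 0}. b' \<bullet> b)"
    by (simp add: inward_def inner_sum_left)
  also have "\<dots> = (\<Sum>b'\<in>{b \<in> chart_corner c. chart_map c p \<bullet> b = 0}. if b' = b then 1 else 0)"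
    using ch(2) b by (intro sum.cong refl) (auto simp: inner_Basis subset_iff)
  also have "\<dots> = (if chart_map c p \<bullet> b = 0 then 1 else 0)"
    using fin b by simp
  finally show ?thesis .
qed

lemma inward_ray_in_chart:
  assumes c: "c \<in> A" "p \<in> chart_dom c"
  shows "eventually (\<lambda>t. chart_map c p + t *\<^sub>R inward c p \<in> chart_image c) (at_right 0)"
  using ray_in_chart_image[OF c(1) is_chartD(5)[OF chart[OF c(1)] c(2)]] inner_inward[OF c(1)] by simp

lemma mfd_interiorI:
  assumes "c \<in> A" "q \<in> chart_dom c" "\<And>b. b \<in> chart_corner c \<Longrightarrow> chart_map c q \<bullet> b \<noteq> 0"
  shows "q \<in> mfd_interior X A"
proof -
  have "{b \<in> chart_corner c. chart_map c q \<bullet> b = 0} = {}" using assms by auto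
  moreover have "q \<in> topspace X"
    using openin_subset[OF is_chartD(1)[OF chart]] assms by blast
  ultimately show ?thesis using assms(1,2) unfolding mfd_interior_def depth_stratum_def
    by (intro CollectI conjI bexI[of _ c]) (simp_all only: card.empty)
qed

lemma inward_ray_in_interior:
  assumes c: "c \<in> A" "p \<in> chart_dom c"
  shows "eventually (\<lambda>t. inward_ray c p t \<in> mfd_interior X A) (at_right 0)"
  using inward_ray_in_chart[OF c] eventually_at_right_less[of "0::real"]
proof eventually_elim
  case (elim t)
  note ch = is_chartD[OF chart[OF c(1)]]
  obtain V where V: "chart_image c = corner_model (chart_corner c) \<inter> V"
    using ch(3) unfolding openin_open by blast
  have "0 \<le> chart_map c p \<bullet> b" if "b \<in> chart_corner c" for b
    using ch(5)[OF c(2)] V that by (auto simp: corner_model_def)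
  then have "(chart_map c p + t *\<^sub>R inward c p) \<bullet> b > 0" if "b \<in> chart_corner c" for b
    using elim inner_inward[OF c(1) that, of p] that by (force simp: inner_add_left)
  then show ?case
    using elim ch(6,7) unfolding inward_ray_def by (intro mfd_interiorI[OF c(1)]) force+
qed

lemma inward_ray_tendsto:
  assumes c: "c \<in> A" "p \<in> chart_dom c"
  shows "limitin X (inward_ray c p) p (at_right 0)"
proof -
  note ch = is_chartD[OF chart[OF c(1)]]
  have "((\<lambda>t. chart_map c p + t *\<^sub>R inward c p) \<longlongrightarrow> chart_map c p) (at_right 0)"
    by (auto intro!: tendsto_eq_intros)
  then have "limitin (top_of_set (chart_image c)) (\<lambda>t. chart_map c p + t *\<^sub>R inward c p) (chart_map c p) (at_right 0)"
    using inward_ray_in_chart[OF c] ch(5)[OF c(2)] by (simp add: limitin_subtopology)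
  from continuous_map_limit[OF ch(9) this] show ?thesis
    using ch(4)[OF c(2)] by (simp add: o_def inward_ray_def[abs_def])
qed

text \<open>By embeddedness the function vanishes near \<open>p\<close> on the hyperplane where
  coordinate \<open>b\<close> is zero, so its differential \<open>D\<close> annihilates all basis
  directions but \<open>b\<close>. As \<open>D\<close> is not zero and the function is nonnegative,
  \<open>D b > 0\<close>; this is the slope along the inward ray, because \<open>b\<close> is active
  at \<open>p\<close>.\<close>

lemma boundary_defining_growth:
  assumes \<rho>: "boundary_defining X A H \<rho>" and H: "embedded_hypersurface X A H"
    and c: "c \<in> A" "p \<in> chart_dom c" and p: "p \<in> H"
  obtains k where "0 < k" "eventually (\<lambda>t. k * t \<le> \<rho> (inward_ray c p t)) (at_right 0)"
proof -
  note ch = is_chartD[OF chart[OF c(1)]]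
  define x0 where "x0 = chart_map c p"
  define f where "f = \<rho> \<circ> chart_inv c"
  have x0: "x0 \<in> chart_image c" using ch(5) c by (simp add: x0_def)
  obtain D where D: "(f has_derivative D) (at x0 within chart_image c)" "D \<noteq> (\<lambda>_. 0)"
    using \<rho> p c unfolding boundary_defining_def differential_nonzero_def f_def x0_def by blast
  interpret D: linear D using D(1) has_derivative_linear by blast
  obtain b W where b: "b \<in> chart_corner c" and W: "openin X W" "p \<in> W" "W \<subseteq> chart_dom c"
    and HW: "H \<inter> W = {q \<in> W. chart_map c q \<bullet> b = 0}"
    using H c p unfolding embedded_hypersurface_def by blast
  have f0: "f x0 = 0" using boundary_definingD(1)[OF \<rho> p] ch(4)[OF c(2)] by (simp add: f_def x0_def)
  have bB: "b \<in> Basis" using b ch(2) by auto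
  have x0b: "x0 \<bullet> b = 0" using HW p W by (auto simp: x0_def)
  have fnn: "0 \<le> f x" if "x \<in> chart_image c" for x
  proof -
    have "chart_inv c x \<in> topspace X" using openin_subset[OF ch(1)] ch(7)[OF that] by auto
    then show ?thesis using boundary_definingD(3)[OF \<rho>] by (simp add: f_def)
  qed
  \<comment> \<open>The ray in direction \<open>b'\<close> keeps coordinate \<open>b\<close> at
    zero, so for small parameters it stays in \<open>H\<close>.\<close>
  have D0: "D b' = 0" if b': "b' \<in> Basis" "b' \<noteq> b" for b'
  proof -
    have ev: "eventually (\<lambda>t. x0 + t *\<^sub>R b' \<in> chart_image c) (at_right 0)"
      using ch(2) b' by (intro ray_in_chart_image[OF c(1) x0]) (auto simp: inner_Basis)
    have "((\<lambda>t. x0 + t *\<^sub>R b') \<longlongrightarrow> x0) (at_right 0)"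
      by (auto intro!: tendsto_eq_intros)
    then have "limitin (top_of_set (chart_image c)) (\<lambda>t. x0 + t *\<^sub>R b') x0 (at_right 0)"
      using ev x0 by (simp add: limitin_subtopology)
    from continuous_map_limit[OF ch(9) this]
    have "limitin X (\<lambda>t. chart_inv c (x0 + t *\<^sub>R b')) p (at_right 0)"
      using ch(4) c by (simp add: o_def x0_def)
    then have "eventually (\<lambda>t. chart_inv c (x0 + t *\<^sub>R b') \<in> W) (at_right 0)"
      using W by (simp add: limitin_def)
    with ev have "eventually (\<lambda>t. (f (x0 + t *\<^sub>R b') - f x0) / t = 0) (at_right 0)"
    proof eventually_elim
      case (elim t)
      have "(x0 + t *\<^sub>R b') \<bullet> b = 0" using x0b b' bB by (simp add: inner_add_left inner_Basis)
      then have "chart_inv c (x0 + t *\<^sub>R b') \<in> H" using elim ch(6) HW by auto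
      then have "f (x0 + t *\<^sub>R b') = 0" using boundary_definingD(1)[OF \<rho>] by (simp add: f_def)
      then show ?case by (simp add: f0)
    qed
    then have "((\<lambda>t. 0) \<longlongrightarrow> D b') (at_right (0::real))"
      by (rule Lim_transform_eventually[OF has_derivative_ray[OF D(1) x0 ev]])
    then show ?thesis using tendsto_unique[OF trivial_limit_at_right_real] tendsto_const by blast
  qed
  have Du: "D u = (u \<bullet> b) * D b" for u
  proof -
    have "D u = D (\<Sum>b'\<in>Basis. (u \<bullet> b') *\<^sub>R b')" by (simp add: euclidean_representation)
    also have "\<dots> = (\<Sum>b'\<in>Basis. (u \<bullet> b') * D b')" by (simp add: D.sum D.scaleR)
    also have "\<dots> = (\<Sum>b'\<in>Basis. if b' = b then (u \<bullet> b) * D b else 0)"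
      using D0 by (intro sum.cong) auto
    finally show ?thesis using bB by simp
  qed
  define v where "v = inward c p"
  have vb: "v \<bullet> b = 1" using inner_inward[OF c(1) b, of p] x0b by (simp add: v_def x0_def)
  have ev: "eventually (\<lambda>t. x0 + t *\<^sub>R v \<in> chart_image c) (at_right 0)"
    using inward_ray_in_chart[OF c] by (simp add: x0_def v_def)
  have lim: "((\<lambda>t. (f (x0 + t *\<^sub>R v) - f x0) / t) \<longlongrightarrow> D b) (at_right 0)"
    using has_derivative_ray[OF D(1) x0 ev] Du[of v] vb by simp
  have "0 \<le> D b"
  proof (rule tendsto_lowerbound[OF lim])
    show "eventually (\<lambda>t. 0 \<le> (f (x0 + t *\<^sub>R v) - f x0) / t) (at_right 0)"
      using ev eventually_at_right_less[of "0::real"] by eventually_elim (use fnn f0 in auto)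
  qed simp
  moreover have "D b \<noteq> 0"
  proof
    assume "D b = 0"
    then have "D u = 0" for u using Du[of u] by (simp only: mult_zero_right)
    then have "D = (\<lambda>_. 0)" by (rule ext)
    with D(2) show False by simp
  qed
  ultimately have Db: "0 < D b" by simp
  then have "eventually (\<lambda>t. D b / 2 < (f (x0 + t *\<^sub>R v) - f x0) / t) (at_right 0)"
    by (intro order_tendstoD(1)[OF lim]) simp
  \<comment> \<open>Half of the limiting slope leaves room for the strict inequality.\<close>
  then have "eventually (\<lambda>t. D b / 2 * t \<le> \<rho> (inward_ray c p t)) (at_right 0)"
    using eventually_at_right_less[of "0::real"]
    by eventually_elim (use f0 in \<open>auto simp: f_def inward_ray_def x0_def v_def field_simps\<close>)
  then show thesis using that[of "D b / 2"] Db by simp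
qed

text \<open>The competing curve is the segment of the ray itself, parametrised affinely by
  \<open>{0..1}\<close>. Its speed is at most a constant times the power \<open>- s / 2\<close> of
  the ray parameter, whose antiderivative is a multiple of the positive power
  \<open>1 - s / 2\<close>.\<close>

lemma riem_dist_inward_ray_le:
  assumes c: "c \<in> A" "p \<in> chart_dom c" and s: "s < 2" and CG: "0 \<le> C" "0 \<le> G"
    and seg: "\<And>t. 0 < t \<Longrightarrow> t < \<delta> \<Longrightarrow> chart_map c p + t *\<^sub>R inward c p \<in> chart_image c"
    and int: "\<And>t. 0 < t \<Longrightarrow> t < \<delta> \<Longrightarrow> inward_ray c p t \<in> mfd_interior X A"
    and w: "\<And>t. 0 < t \<Longrightarrow> t < \<delta> \<Longrightarrow> w (inward_ray c p t) \<le> C * t powr (- s)"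
    and G: "\<And>t. 0 < t \<Longrightarrow> t < \<delta> \<Longrightarrow> g c (inward_ray c p t) (inward c p) (inward c p) \<le> G"
    and a: "0 < a" "a < \<delta>" and b: "0 < b" "b < \<delta>"
  shows "riem_dist X A (conformal w g) (inward_ray c p a) (inward_ray c p b)
    \<le> ennreal (sqrt (C * G) / (1 - s / 2) * \<bar>b powr (1 - s / 2) - a powr (1 - s / 2)\<bar>)"
proof -
  note ch = is_chartD[OF chart[OF c(1)]]
  define v where "v = inward c p"
  define \<tau> where "\<tau> u = a + u * (b - a)" for u :: real
  define x where "x u = chart_map c p + \<tau> u *\<^sub>R v" for u
  define \<sigma> where "\<sigma> u = inward_ray c p (\<tau> u)" for u
  have \<tau>: "0 < \<tau> u" "\<tau> u < \<delta>" if u: "u \<in> {0..1}" for u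
  proof -
    have e: "\<tau> u = (1 - u) * a + u * b" by (simp add: \<tau>_def algebra_simps)
    \<comment> \<open>The order of \<open>a\<close> and \<open>b\<close> is not fixed, since both
      orders occur in the Cauchy condition.\<close>
    have "\<tau> u \<in> {min a b..max a b}"
    proof -
      have "(1 - u) * min a b + u * min a b \<le> \<tau> u" "\<tau> u \<le> (1 - u) * max a b + u * max a b"
        unfolding e using u by (auto intro!: add_mono mult_left_mono)
      then show ?thesis by (simp add: algebra_simps)
    qed
    then show "0 < \<tau> u" "\<tau> u < \<delta>" using a b by auto
  qed
  have ximg: "x u \<in> chart_image c" if "u \<in> {0..1}" for u
    using seg \<tau>[OF that] by (simp add: x_def v_def)
  have \<sigma>x: "\<sigma> u = chart_inv c (x u)" for u by (simp add: \<sigma>_def inward_ray_def x_def v_def)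
  have \<sigma>c: "\<sigma> u \<in> chart_dom c" "chart_map c (\<sigma> u) = x u" if "u \<in> {0..1}" for u
    using ch(6,7) ximg[OF that] by (auto simp: \<sigma>x)
  have dx: "(x has_vector_derivative (b - a) *\<^sub>R v) (at u within S)" for u S
    unfolding x_def \<tau>_def by (auto intro!: derivative_eq_intros)
  have "continuous_on {0..1} x" unfolding x_def \<tau>_def by (intro continuous_intros)
  then have "continuous_map (top_of_set {0..1}) (top_of_set (chart_image c)) x"
    using ximg by (auto simp: continuous_map_in_subtopology)
  from continuous_map_compose[OF this ch(9)]
  have c\<sigma>: "continuous_map (top_of_set {0..1}) X \<sigma>" by (simp add: o_def \<sigma>x[abs_def])
  have C1: "C1_curve X A \<sigma> 0 1"
    unfolding C1_curve_def
  proof (intro conjI ballI c\<sigma>)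
    fix c' assume c': "c' \<in> A"
    define T where "T = {t \<in> {0..1}. \<sigma> t \<in> chart_dom c'}"
    have T: "openin (top_of_set {0..1}) T"
      using openin_continuous_map_preimage[OF c\<sigma> is_chartD(1)[OF chart[OF c']]] by (simp add: T_def)
    have sm: "smooth_within (chart_map c' \<circ> chart_inv c) (chart_map c ` (chart_dom c \<inter> chart_dom c'))"
      using transition[OF c(1) c'] by (simp add: smooth_transition_def)
    obtain D where "continuous_on T D"
      "\<And>t. t \<in> T \<Longrightarrow> ((chart_map c' \<circ> \<sigma>) has_vector_derivative D t) (at t within {0..1})"
    proof (rule smooth_curve[OF sm zero_less_one T, of x "chart_map c' \<circ> \<sigma>" "\<lambda>_. (b - a) *\<^sub>R v"])
      fix t assume "t \<in> T"
      then show "x t \<in> chart_map c ` (chart_dom c \<inter> chart_dom c')"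
        using \<sigma>c[of t] by (intro image_eqI[of _ _ "\<sigma> t"]) (auto simp: T_def)
    qed (use dx in \<open>auto simp: \<sigma>x\<close>)
    then show "\<exists>D. continuous_on {t \<in> {0..1}. \<sigma> t \<in> chart_dom c'} D \<and>
        (\<forall>t\<in>{0..1}. \<sigma> t \<in> chart_dom c' \<longrightarrow>
           ((chart_map c' \<circ> \<sigma>) has_vector_derivative D t) (at t within {0..1}))"
      by (auto simp: T_def)
  qed
  have pw: "piecewise_C1_curve X A \<sigma>"
    unfolding piecewise_C1_curve_def using C1
    \<comment> \<open>A single piece: the subdivision points are \<open>0\<close> and
      \<open>1\<close>.\<close>
    by (intro exI[of _ 1] exI[of _ "\<lambda>k. real k"]) auto
  define \<theta> where "\<theta> = 1 - s / 2"
  have \<theta>: "0 < \<theta>" using s by (simp add: \<theta>_def)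
  define f where "f u = \<bar>b - a\<bar> * sqrt (C * G) * \<tau> u powr (\<theta> - 1)" for u
  \<comment> \<open>The sign lets one antiderivative of the nonnegative \<open>f\<close> serve
    whichever of \<open>a\<close> and \<open>b\<close> is larger.\<close>
  define F where "F u = sgn (b - a) * sqrt (C * G) / \<theta> * \<tau> u powr \<theta>" for u
  have speed: "speed A (conformal w g) \<sigma> u \<le> f u" if u: "0 < u" "u < 1" for u
  proof -
    have u': "u \<in> {0..1}" using u by auto
    have "((\<lambda>u. chart_map c (\<sigma> u)) has_vector_derivative (b - a) *\<^sub>R v) (at u within {0..1})"
      using has_vector_derivative_transform[OF u' \<sigma>c(2) dx] .
    then have d\<sigma>: "((chart_map c \<circ> \<sigma>) has_vector_derivative (b - a) *\<^sub>R v) (at u)"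
      using u by (simp add: at_within_Icc_at o_def)
    have "speed A (conformal w g) \<sigma> u = sqrt (w (\<sigma> u) * g c (\<sigma> u) ((b - a) *\<^sub>R v) ((b - a) *\<^sub>R v))"
      by (rule speed_eq[OF c(1) \<sigma>c(1)[OF u'] C1_curve_near[OF C1 u] d\<sigma>])
    also have "\<dots> = \<bar>b - a\<bar> * sqrt (w (\<sigma> u) * g c (\<sigma> u) v v)"
      by (simp add: metric_scale[OF c(1) \<sigma>c(1)[OF u']] real_sqrt_mult)
    also have "\<dots> \<le> \<bar>b - a\<bar> * sqrt ((C * \<tau> u powr (- s)) * G)"
      using w[OF \<tau>[OF u']] G[OF \<tau>[OF u']] CG metric_nonneg[OF c(1) \<sigma>c(1)[OF u'], of v]
      by (intro mult_left_mono real_sqrt_le_mono mult_mono) (auto simp: \<sigma>_def v_def)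
    also have "sqrt ((C * \<tau> u powr (- s)) * G) = sqrt (C * G) * sqrt (\<tau> u powr (- s))"
      by (simp add: real_sqrt_mult[symmetric] mult_ac)
    also have "sqrt (\<tau> u powr (- s)) = \<tau> u powr (\<theta> - 1)"
      by (simp add: powr_half_sqrt[symmetric] powr_powr \<theta>_def)
    finally show ?thesis by (simp add: f_def mult.assoc)
  qed
  have "curve_length A (conformal w g) \<sigma> \<le> (\<integral>\<^sup>+u. ennreal (f u) * indicator {0..1} u \<partial>lborel)"
    unfolding curve_length_def
  proof (rule nn_integral_mono_AE)
    show "AE u in lborel. ennreal (speed A (conformal w g) \<sigma> u) * indicator {0..1} u
        \<le> ennreal (f u) * indicator {0..1} u"
      using AE_lborel_singleton[of 0] AE_lborel_singleton[of 1]
      by eventually_elim (use speed in \<open>auto simp: indicator_def intro!: ennreal_leI\<close>)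
  qed
  also have "\<dots> = ennreal (F 1 - F 0)"
  proof (rule nn_integral_FTC_Icc)
    show "f \<in> borel_measurable borel" unfolding f_def \<tau>_def by measurable
    fix u :: real assume u: "u \<in> {0..1}"
    then have pos: "0 < \<tau> u" using \<tau> by auto
    have "(\<tau> has_real_derivative (b - a)) (at u)"
      unfolding \<tau>_def by (auto intro!: derivative_eq_intros)
    from DERIV_cmult[OF DERIV_fun_powr[OF this pos, of \<theta>], of "sgn (b - a) * sqrt (C * G) / \<theta>"]
    have "(F has_real_derivative sgn (b - a) * sqrt (C * G) / \<theta> * (\<theta> * \<tau> u powr (\<theta> - 1) * (b - a))) (at u)"
      by (simp only: F_def[abs_def] of_nat_1)
    moreover have "sgn (b - a) * sqrt (C * G) / \<theta> * (\<theta> * \<tau> u powr (\<theta> - 1) * (b - a)) = f u"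
      using \<theta> by (simp add: f_def abs_sgn mult_ac)
    ultimately show "(F has_real_derivative f u) (at u)" by simp
    show "0 \<le> f u" unfolding f_def using CG by simp
  qed simp
  also have "F 1 - F 0 = sqrt (C * G) / \<theta> * (sgn (b - a) * (b powr \<theta> - a powr \<theta>))"
    by (simp add: F_def \<tau>_def algebra_simps)
  also have "sgn (b - a) * (b powr \<theta> - a powr \<theta>) = \<bar>b powr \<theta> - a powr \<theta>\<bar>"
    using a b \<theta> powr_mono2[of \<theta> a b] powr_mono2[of \<theta> b a] by (auto simp: sgn_if)
  finally have "curve_length A (conformal w g) \<sigma> \<le> ennreal (sqrt (C * G) / \<theta> * \<bar>b powr \<theta> - a powr \<theta>\<bar>)" .
  moreover have "\<sigma> ` {0..1} \<subseteq> mfd_interior X A" using int \<tau> by (auto simp: \<sigma>_def)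
  moreover have "\<sigma> 0 = inward_ray c p a" "\<sigma> 1 = inward_ray c p b" by (auto simp: \<sigma>_def \<tau>_def)
  ultimately show ?thesis
    unfolding riem_dist_def \<theta>_def[symmetric] using pw by (intro INF_lower2[of \<sigma>]) auto
qed

text \<open>Points of one ray are enough: the distance between parameters \<open>a\<close> and
  \<open>b\<close> is at most \<open>K\<close> times the difference of their powers with exponent
  \<open>\<theta> > 0\<close>, and these powers tend to \<open>0\<close> along any sequence of
  parameters tending to \<open>0\<close>.\<close>

lemma accessible_pointI:
  assumes c: "c \<in> A" "p \<in> chart_dom c" and s: "s < 2" and C: "0 \<le> C"
    and w: "eventually (\<lambda>t. w (inward_ray c p t) \<le> C * t powr (- s)) (at_right 0)"
  shows "accessible_point X A (conformal w g) p"
proof -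
  note ch = is_chartD[OF chart[OF c(1)]]
  define v where "v = inward c p"
  define h where "h x = g c (chart_inv c x) v v" for x
  have "((\<lambda>t. chart_map c p + t *\<^sub>R v) \<longlongrightarrow> chart_map c p) (at_right 0)"
    by (auto intro!: tendsto_eq_intros)
  then have lim: "limitin (top_of_set (chart_image c)) (\<lambda>t. chart_map c p + t *\<^sub>R v) (chart_map c p) (at_right 0)"
    using inward_ray_in_chart[OF c] ch(5)[OF c(2)] by (simp add: limitin_subtopology v_def)
  have "continuous_map (top_of_set (chart_image c)) euclideanreal h"
    using smooth_within_continuous_on[OF metric_smooth[OF c(1)]] by (simp add: h_def)
  from continuous_map_limit[OF this lim]
  have "((\<lambda>t. h (chart_map c p + t *\<^sub>R v)) \<longlongrightarrow> h (chart_map c p)) (at_right 0)" by (simp add: o_def)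
  \<comment> \<open>By continuity of the metric up to the boundary, its value on the inward vector
    stays below its value at \<open>p\<close> plus \<open>1\<close>.\<close>
  define G where "G = h (chart_map c p) + 1"
  have G0: "0 \<le> G" using metric_nonneg[OF c] ch(4)[OF c(2)] by (simp add: G_def h_def)
  have evG: "eventually (\<lambda>t. h (chart_map c p + t *\<^sub>R v) < G) (at_right 0)"
    by (rule order_tendstoD(2)[OF \<open>((\<lambda>t. h (chart_map c p + t *\<^sub>R v)) \<longlongrightarrow> h (chart_map c p)) (at_right 0)\<close>])
      (simp add: G_def)
  have "eventually (\<lambda>t. chart_map c p + t *\<^sub>R inward c p \<in> chart_image c \<and>
      inward_ray c p t \<in> mfd_interior X A \<and> w (inward_ray c p t) \<le> C * t powr (- s) \<and>
      g c (inward_ray c p t) (inward c p) (inward c p) \<le> G) (at_right 0)"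
    using inward_ray_in_chart[OF c] inward_ray_in_interior[OF c] w evG
    by eventually_elim (auto simp: h_def v_def inward_ray_def)
  then obtain \<delta> where \<delta>: "0 < \<delta>" and ev: "\<And>t. 0 < t \<Longrightarrow> t < \<delta> \<Longrightarrow>
      chart_map c p + t *\<^sub>R inward c p \<in> chart_image c \<and>
      inward_ray c p t \<in> mfd_interior X A \<and> w (inward_ray c p t) \<le> C * t powr (- s) \<and>
      g c (inward_ray c p t) (inward c p) (inward c p) \<le> G"
    unfolding eventually_at_right_field by auto
  define \<theta> where "\<theta> = 1 - s / 2"
  have \<theta>: "0 < \<theta>" using s by (simp add: \<theta>_def)
  define K where "K = sqrt (C * G) / \<theta>"
  have K: "0 \<le> K" using C G0 \<theta> by (simp add: K_def)
  have dist: "riem_dist X A (conformal w g) (inward_ray c p a) (inward_ray c p b)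
      \<le> ennreal (K * \<bar>b powr \<theta> - a powr \<theta>\<bar>)"
    if "0 < a" "a < \<delta>" "0 < b" "b < \<delta>" for a b
    unfolding K_def \<theta>_def by (rule riem_dist_inward_ray_le[OF c s C G0]) (use ev that in auto)
  \<comment> \<open>The shift by \<open>2\<close> gives \<open>r n < \<delta>\<close> already for
    \<open>n = 0\<close>.\<close>
  define r where "r n = \<delta> / real (n + 2)" for n
  have r: "0 < r n" "r n < \<delta>" for n
    using \<delta> mult_strict_left_mono[of 1 "real (n + 2)" \<delta>] by (auto simp: r_def divide_less_eq)
  have r0: "r \<longlonglongrightarrow> 0"
    using LIMSEQ_ignore_initial_segment[OF lim_const_over_n[of \<delta>], of 2] by (simp add: r_def[abs_def])
  have "(\<lambda>n. K * r n powr \<theta>) \<longlonglongrightarrow> K * 0 powr \<theta>"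
    by (rule tendsto_mult_left, rule tendsto_powr'[OF r0 tendsto_const])
      (use r(1) \<theta> in \<open>auto intro!: always_eventually simp: less_imp_le\<close>)
  then have "(\<lambda>n. ennreal (K * r n powr \<theta>)) \<longlonglongrightarrow> 0"
    using tendsto_ennrealI by fastforce
  then have small: "eventually (\<lambda>n. ennreal (K * r n powr \<theta>) < \<epsilon>) sequentially" if "0 < \<epsilon>" for \<epsilon>
    using that by (rule order_tendstoD(2))
  show ?thesis
    unfolding accessible_point_def
  proof (intro exI[of _ "\<lambda>n. inward_ray c p (r n)"] conjI allI impI)
    show "inward_ray c p (r n) \<in> mfd_interior X A" for n using ev r by blast
    show "limitin X (\<lambda>n. inward_ray c p (r n)) p sequentially"
    proof -
      have "filterlim r (at_right 0) sequentially" using r0 r(1) by (auto simp: filterlim_at less_imp_neq[symmetric])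
      with inward_ray_tendsto[OF c] show ?thesis
        unfolding limitin_def by (auto dest: eventually_compose_filterlim)
    qed
    fix \<epsilon> :: ennreal assume "0 < \<epsilon>"
    then obtain M where M: "\<And>n. n \<ge> M \<Longrightarrow> ennreal (K * r n powr \<theta>) < \<epsilon>"
      using small by (auto simp: eventually_sequentially)
    show "\<exists>M. \<forall>m\<ge>M. \<forall>n\<ge>M. riem_dist X A (conformal w g) (inward_ray c p (r m)) (inward_ray c p (r n)) < \<epsilon>"
    proof (intro exI[of _ M] allI impI)
      fix m n assume mn: "m \<ge> M" "n \<ge> M"
      have "\<bar>r n powr \<theta> - r m powr \<theta>\<bar> \<le> max (r m powr \<theta>) (r n powr \<theta>)"
        by (auto simp: max_def abs_if)
      then have "K * \<bar>r n powr \<theta> - r m powr \<theta>\<bar> \<le> max (K * r m powr \<theta>) (K * r n powr \<theta>)"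
        using K by (metis max_mult_distrib_left mult_left_mono)
      then have "ennreal (K * \<bar>r n powr \<theta> - r m powr \<theta>\<bar>) \<le> ennreal (max (K * r m powr \<theta>) (K * r n powr \<theta>))"
        by (rule ennreal_leI)
      also have "\<dots> < \<epsilon>" using M[OF mn(1)] M[OF mn(2)] by (simp add: max_def)
      finally show "riem_dist X A (conformal w g) (inward_ray c p (r m)) (inward_ray c p (r n)) < \<epsilon>"
        using dist[OF r r] le_less_trans by blast
    qed
  qed
qed

end

section \<open>Accessibility of open faces\<close>

text \<open>Put \<open>r = R / B \<le> 1\<close>. For \<open>i \<in> I\<close> one has
  \<open>\<rho> i \<le> B * r\<close>, otherwise \<open>\<rho> i \<le> B\<close>; the exponents are
  nonpositive, so each factor is bounded below accordingly. As \<open>r \<le> 1\<close>, the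
  collected exponent of \<open>r\<close> may be raised to \<open>- 2\<close>, and
  \<open>r powr (- 2)\<close> accounts for the factor \<open>B\<^sup>2\<close>.\<close>

lemma prod_powr_ge:
  fixes \<rho> \<alpha> :: "'i \<Rightarrow> real"
  assumes J: "finite J" "I \<subseteq> J" and \<rho>: "\<And>i. i \<in> J \<Longrightarrow> 0 < \<rho> i" "\<And>i. i \<in> J \<Longrightarrow> \<rho> i \<le> B"
    and R: "\<And>i. i \<in> I \<Longrightarrow> \<rho> i \<le> R" "0 < R" "R \<le> B"
    and \<alpha>: "\<And>i. i \<in> J \<Longrightarrow> 0 \<le> \<alpha> i" "2 \<le> (\<Sum>i\<in>I. \<alpha> i)"
  shows "((\<Prod>i\<in>J. B powr (- \<alpha> i)) * B\<^sup>2) / R\<^sup>2 \<le> (\<Prod>i\<in>J. \<rho> i powr (- \<alpha> i))"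
proof -
  define r where "r = R / B"
  have B: "0 < B" using R by simp
  have r: "0 < r" "r \<le> 1" using R B by (auto simp: r_def)
  have "((\<Prod>i\<in>J. B powr (- \<alpha> i)) * B\<^sup>2) / R\<^sup>2 = (\<Prod>i\<in>J. B powr (- \<alpha> i)) * r powr (- 2)"
    using r R B by (simp add: r_def powr_minus powr_numeral power_divide)
  also have "\<dots> \<le> (\<Prod>i\<in>J. B powr (- \<alpha> i)) * r powr (\<Sum>i\<in>I. - \<alpha> i)"
    using r \<alpha>(2) by (intro mult_left_mono powr_mono' prod_nonneg) (auto simp: sum_negf)
  also have "\<dots> = (\<Prod>i\<in>J. B powr (- \<alpha> i)) * (\<Prod>i\<in>J. if i \<in> I then r powr (- \<alpha> i) else 1)"
    using J r by (simp add: powr_sum finite_subset prod.If_cases Int_absorb1)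
  also have "\<dots> = (\<Prod>i\<in>J. B powr (- \<alpha> i) * (if i \<in> I then r powr (- \<alpha> i) else 1))"
    by (simp add: prod.distrib)
  also have "\<dots> \<le> (\<Prod>i\<in>J. \<rho> i powr (- \<alpha> i))"
  proof (intro prod_mono conjI)
    fix i assume i: "i \<in> J"
    show "B powr (- \<alpha> i) * (if i \<in> I then r powr (- \<alpha> i) else 1) \<le> \<rho> i powr (- \<alpha> i)"
    proof (cases "i \<in> I")
      case True
      have "B powr (- \<alpha> i) * r powr (- \<alpha> i) = R powr (- \<alpha> i)"
        using B r by (simp add: powr_mult[symmetric] r_def)
      also have "\<dots> \<le> \<rho> i powr (- \<alpha> i)" using \<rho> \<alpha>(1) R(1) True i by (intro powr_mono2') auto
      finally show ?thesis using True by simp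
    next
      case False
      then show ?thesis using \<rho> \<alpha>(1) i by (auto intro: powr_mono2')
    qed
  qed auto
  finally show ?thesis .
qed

context riemannian_corner_manifold
begin

text \<open>Embeddedness is applied in the very chart that witnesses depth \<open>0\<close>; it
  would produce a vanishing corner coordinate.\<close>

lemma interior_not_in_hypersurface:
  assumes H: "embedded_hypersurface X A H" and q: "q \<in> mfd_interior X A"
  shows "q \<notin> H"
proof
  assume qH: "q \<in> H"
  obtain c where c: "c \<in> A" "q \<in> chart_dom c" "card {b \<in> chart_corner c. chart_map c q \<bullet> b = 0} = 0"
    using q unfolding mfd_interior_def depth_stratum_def by blast
  have "finite (chart_corner c)"
    using is_chartD(2)[OF chart[OF c(1)]] finite_Basis finite_subset by blast
  then have "{b \<in> chart_corner c. chart_map c q \<bullet> b = 0} = {}" using c(3) by simp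
  moreover obtain b W where "b \<in> chart_corner c" "q \<in> W" "H \<inter> W = {q \<in> W. chart_map c q \<bullet> b = 0}"
    using H c qH unfolding embedded_hypersurface_def by blast
  ultimately show False using qH by blast
qed

lemma continuous_bounded_above:
  assumes "compact_space X" "continuous_map X euclideanreal f"
  obtains B where "1 \<le> B" "\<And>q. q \<in> topspace X \<Longrightarrow> f q \<le> B"
proof -
  have "compactin euclideanreal (f ` topspace X)"
    using assms image_compactin compact_space_def by blast
  then have "bounded (f ` topspace X)" by (simp add: compact_imp_bounded)
  then obtain B where "\<And>q. q \<in> topspace X \<Longrightarrow> \<bar>f q\<bar> \<le> B" by (auto simp: bounded_iff)
  then show thesis using that[of "max 1 B"] by fastforce
qed

end

section \<open>The interaction weights and their behaviour at a face\<close>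

locale corner_interaction =
  fixes X :: "'x topology" and A :: "('x, 'e::euclidean_space) chart set" and N :: nat
    and H :: "nat \<Rightarrow> 'x set" and \<rho> :: "nat \<Rightarrow> 'x \<Rightarrow> real" and g :: "('x, 'e) tensor2"
    and \<alpha> :: "nat \<Rightarrow> real"
  assumes data: "corner_data X A N H \<rho> g \<alpha>"

sublocale corner_interaction \<subseteq> riemannian_corner_manifold X A g
  using data by unfold_locales (auto simp: corner_data_def)

context corner_interaction
begin

lemma compact: "compact_space X"
  using data by (simp add: corner_data_def)

lemma hypersurface:
  assumes "i \<in> {1..N}"
  shows "embedded_hypersurface X A (H i)" "boundary_defining X A (H i) (\<rho> i)" "0 \<le> \<alpha> i"
  using data assms by (auto simp: corner_data_def)

lemma interior_pos: "i \<in> {1..N} \<Longrightarrow> q \<in> mfd_interior X A \<Longrightarrow> 0 < \<rho> i q"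
  using hypersurface interior_not_in_hypersurface boundary_definingD(2)
  by (metis (no_types, lifting) depth_stratum_def mem_Collect_eq mfd_interior_def)

lemma \<rho>_continuous: "i \<in> {1..N} \<Longrightarrow> continuous_map X euclideanreal (\<rho> i)"
  using hypersurface(2) boundary_definingD(4) smooth_fun_continuous by blast

text \<open>One bound for all partial sums: it controls a single \<open>\<rho> i\<close> through a
  singleton and the function \<open>R\<close> through the active set.\<close>

lemma \<rho>_bounded:
  obtains B where "1 \<le> B" "\<And>J q. J \<subseteq> {1..N} \<Longrightarrow> q \<in> topspace X \<Longrightarrow> (\<Sum>i\<in>J. \<rho> i q) \<le> B"
proof -
  have "continuous_map X euclideanreal (\<lambda>q. \<Sum>i\<in>{1..N}. \<rho> i q)"
    by (intro continuous_map_sum \<rho>_continuous) auto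
  then obtain B where B: "1 \<le> B" "\<And>q. q \<in> topspace X \<Longrightarrow> (\<Sum>i\<in>{1..N}. \<rho> i q) \<le> B"
    using continuous_bounded_above[OF compact] by blast
  have "(\<Sum>i\<in>J. \<rho> i q) \<le> B" if "J \<subseteq> {1..N}" "q \<in> topspace X" for J q
  proof -
    have "(\<Sum>i\<in>J. \<rho> i q) \<le> (\<Sum>i\<in>{1..N}. \<rho> i q)"
    proof (rule sum_mono2[OF finite_atLeastAtMost that(1)])
      fix i assume "i \<in> {1..N} - J"
      then have "i \<in> {1..N}" by blast
      from boundary_definingD(3)[OF hypersurface(2)[OF this] that(2)] show "0 \<le> \<rho> i q" .
    qed
    with B(2)[OF that(2)] show ?thesis by simp
  qed
  with B(1) show thesis using that by blast
qed

text \<open>Two index sets let one argument serve both interactions. For the product,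
  \<open>J\<close> is the full index set and the factors outside \<open>I\<close> contribute only a
  positive constant; for the sum, \<open>I\<close> and \<open>J\<close> are the same singleton,
  because one summand bounds the sum from below.\<close>

lemma inaccessibleI:
  assumes I: "I \<subseteq> J" "J \<subseteq> {1..N}" "I \<noteq> {}" and s: "2 \<le> (\<Sum>i\<in>I. \<alpha> i)"
    and p: "\<And>i. i \<in> I \<Longrightarrow> p \<in> H i"
    and w: "\<And>q. q \<in> mfd_interior X A \<Longrightarrow> (\<Prod>i\<in>J. \<rho> i q powr (- \<alpha> i)) \<le> w q"
  shows "\<not> accessible_point X A (conformal w g) p"
proof -
  have fin: "finite J" "finite I"
    using I(1,2) by (meson finite_atLeastAtMost finite_subset)+
  obtain B where B: "1 \<le> B" "\<And>J q. J \<subseteq> {1..N} \<Longrightarrow> q \<in> topspace X \<Longrightarrow> (\<Sum>i\<in>J. \<rho> i q) \<le> B"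
    using \<rho>_bounded by blast
  have top: "q \<in> topspace X" if "q \<in> mfd_interior X A" for q
    using that by (simp add: mfd_interior_def depth_stratum_def)
  define R where "R q = (\<Sum>i\<in>I. \<rho> i q)" for q
  have "\<forall>i\<in>I. \<exists>C>0. lipschitz_along (\<rho> i) C"
  proof
    fix i assume "i \<in> I"
    then have "smooth_fun A (\<rho> i)" using I hypersurface(2) boundary_definingD(4) by blast
    then show "\<exists>C>0. lipschitz_along (\<rho> i) C" using smooth_fun_lipschitz_along[OF compact] by metis
  qed
  then obtain C where C: "\<And>i. i \<in> I \<Longrightarrow> 0 < C i" "\<And>i. i \<in> I \<Longrightarrow> lipschitz_along (\<rho> i) (C i)"
    by metis
  have RC: "lipschitz_along R (\<Sum>i\<in>I. C i)"
    unfolding R_def by (rule lipschitz_along_sum[OF fin(2) C(2)])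
  have C0: "0 < (\<Sum>i\<in>I. C i)" using C(1) fin I by (intro sum_pos) auto
  have Rc: "continuous_map X euclideanreal R"
    unfolding R_def using fin I by (intro continuous_map_sum \<rho>_continuous) auto
  have Rpos: "0 < R q" if "q \<in> mfd_interior X A" for q
    unfolding R_def using interior_pos that fin I by (intro sum_pos) auto
  define \<kappa> where "\<kappa> = (\<Prod>i\<in>J. B powr (- \<alpha> i)) * B\<^sup>2"
  have \<kappa>: "0 < \<kappa>" unfolding \<kappa>_def using B(1) by (intro mult_pos_pos prod_pos) auto
  have "\<kappa> / (R q)\<^sup>2 \<le> w q" if q: "q \<in> mfd_interior X A" for q
  proof -
    have pos: "0 < \<rho> i q" if "i \<in> J" for i using interior_pos q I that by blast
    have "\<kappa> / (R q)\<^sup>2 \<le> (\<Prod>i\<in>J. \<rho> i q powr (- \<alpha> i))"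
      unfolding \<kappa>_def
    proof (rule prod_powr_ge[OF fin(1) I(1) pos])
      fix i assume i: "i \<in> J"
      show "\<rho> i q \<le> B" using B(2)[of "{i}" q] top[OF q] i I by auto
      show "0 \<le> \<alpha> i" using hypersurface(3) i I by blast
    next
      fix i assume i: "i \<in> I"
      show "\<rho> i q \<le> R q" unfolding R_def
        using i fin pos I by (intro member_le_sum) (auto intro: less_imp_le)
    qed (use Rpos[OF q] B(2)[of I q] top[OF q] I s in \<open>auto simp: R_def\<close>)
    with w[OF q] show ?thesis by simp
  qed
  moreover have "R p = 0"
    unfolding R_def
  proof (rule sum.neutral, rule ballI)
    fix i assume "i \<in> I"
    then show "\<rho> i p = 0" using boundary_definingD(1)[OF hypersurface(2)] p I by blast
  qed
  ultimately show ?thesis using not_accessible_point[OF RC Rc C0 \<kappa> Rpos] by blast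
qed

text \<open>On the hypersurface this is the linear growth; off it, continuity keeps the function
  above half its value at \<open>p\<close>.\<close>

lemma \<rho>_inward_ray_ge:
  assumes c: "c \<in> A" "p \<in> chart_dom c" and i: "i \<in> {1..N}"
  shows "\<exists>k>0. eventually (\<lambda>t. k * (if p \<in> H i then t else 1) \<le> \<rho> i (inward_ray c p t)) (at_right 0)"
proof (cases "p \<in> H i")
  case True
  then show ?thesis
    using boundary_defining_growth[OF hypersurface(2,1)[OF i] c True] by simp metis
next
  case False
  have "p \<in> topspace X" using openin_subset[OF is_chartD(1)[OF chart[OF c(1)]]] c(2) by blast
  then have pos: "0 < \<rho> i p" using boundary_definingD(2)[OF hypersurface(2)[OF i]] False by blast
  have "((\<lambda>t. \<rho> i (inward_ray c p t)) \<longlongrightarrow> \<rho> i p) (at_right 0)"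
    using continuous_map_limit[OF \<rho>_continuous[OF i] inward_ray_tendsto[OF c]] by (simp add: o_def)
  then have "eventually (\<lambda>t. \<rho> i p / 2 < \<rho> i (inward_ray c p t)) (at_right 0)"
    using pos by (intro order_tendstoD(1)) auto
  then have "eventually (\<lambda>t. \<rho> i p / 2 * 1 \<le> \<rho> i (inward_ray c p t)) (at_right 0)"
    by eventually_elim simp
  with False pos show ?thesis by (intro exI[of _ "\<rho> i p / 2"]) simp
qed

text \<open>Nonpositive exponents turn the lower bounds into upper bounds, with constant
  \<open>k i powr (- \<alpha> i)\<close>. The condition \<open>t < 1\<close> is recorded for the sum
  interaction, where different powers of \<open>t\<close> are compared.\<close>

lemma \<rho>_powr_inward_ray_le:
  assumes c: "c \<in> A" "p \<in> chart_dom c"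
  obtains k where "\<And>i. i \<in> {1..N} \<Longrightarrow> 0 < k i"
    "eventually (\<lambda>t. 0 < t \<and> t < 1 \<and> (\<forall>i\<in>{1..N}. \<rho> i (inward_ray c p t) powr (- \<alpha> i)
       \<le> k i * (if p \<in> H i then t powr (- \<alpha> i) else 1))) (at_right 0)"
proof -
  obtain k where k: "\<And>i. i \<in> {1..N} \<Longrightarrow> 0 < k i"
    "\<And>i. i \<in> {1..N} \<Longrightarrow>
      eventually (\<lambda>t. k i * (if p \<in> H i then t else 1) \<le> \<rho> i (inward_ray c p t)) (at_right 0)"
    using \<rho>_inward_ray_ge[OF c] by metis
  have "eventually (\<lambda>t. \<forall>i\<in>{1..N}. k i * (if p \<in> H i then t else 1) \<le> \<rho> i (inward_ray c p t)) (at_right 0)"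
    using k(2) by (intro eventually_ball_finite) auto
  moreover have "eventually (\<lambda>t::real. t < 1) (at_right 0)"
    by (rule eventually_at_rightI[of 0 1]) auto
  ultimately have "eventually (\<lambda>t. 0 < t \<and> t < 1 \<and> (\<forall>i\<in>{1..N}. \<rho> i (inward_ray c p t) powr (- \<alpha> i)
       \<le> k i powr (- \<alpha> i) * (if p \<in> H i then t powr (- \<alpha> i) else 1))) (at_right 0)"
    using eventually_at_right_less[of "0::real"]
  proof eventually_elim
    case (elim t)
    have "\<rho> i (inward_ray c p t) powr (- \<alpha> i) \<le> k i powr (- \<alpha> i) * (if p \<in> H i then t powr (- \<alpha> i) else 1)"
      if i: "i \<in> {1..N}" for i
    proof -
      have "\<rho> i (inward_ray c p t) powr (- \<alpha> i) \<le> (k i * (if p \<in> H i then t else 1)) powr (- \<alpha> i)"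
        using elim k(1)[OF i] hypersurface(3)[OF i] i by (intro powr_mono2') auto
      also have "\<dots> = k i powr (- \<alpha> i) * (if p \<in> H i then t powr (- \<alpha> i) else 1)"
        using elim k(1)[OF i] by (simp add: powr_mult)
      finally show ?thesis .
    qed
    with elim show ?case by simp
  qed
  with k(1) show thesis using that[of "\<lambda>i. k i powr (- \<alpha> i)"] by force
qed

lemma open_faceD:
  assumes "p \<in> open_face X N H I"
  shows "p \<in> topspace X" "I \<subseteq> {1..N}" "\<And>i. i \<in> {1..N} \<Longrightarrow> p \<in> H i \<longleftrightarrow> i \<in> I"
  using assms by (auto simp: open_face_def active_set_def)

text \<open>Nonemptiness supplies the point at which accessibility contradicts a large exponent sum.
  Conversely each point has its own ray and constants, and the bounds on the single factors
  multiply, so the exponents add.\<close>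

lemma product_accessible_iff:
  assumes I: "I \<noteq> {}" and ne: "open_face X N H I \<noteq> {}"
  shows "accessible X A (product_metric N \<rho> \<alpha> g) (open_face X N H I) \<longleftrightarrow> (\<Sum>i\<in>I. \<alpha> i) < 2"
proof
  assume acc: "accessible X A (product_metric N \<rho> \<alpha> g) (open_face X N H I)"
  obtain p where p: "p \<in> open_face X N H I" using ne by blast
  note pD = open_faceD[OF p]
  show "(\<Sum>i\<in>I. \<alpha> i) < 2"
  proof (rule ccontr)
    assume "\<not> (\<Sum>i\<in>I. \<alpha> i) < 2"
    then have "\<not> accessible_point X A (product_metric N \<rho> \<alpha> g) p"
      unfolding product_metric_def using pD(2,3) I
      by (intro inaccessibleI[of I "{1..N}"]) auto
    with acc p show False by (auto simp: accessible_def)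
  qed
next
  assume s: "(\<Sum>i\<in>I. \<alpha> i) < 2"
  show "accessible X A (product_metric N \<rho> \<alpha> g) (open_face X N H I)"
    unfolding accessible_def
  proof
    fix p assume p: "p \<in> open_face X N H I"
    note pD = open_faceD[OF p]
    obtain c where c: "c \<in> A" "p \<in> chart_dom c" using ex_chart[OF pD(1)] by blast
    obtain k where k: "\<And>i. i \<in> {1..N} \<Longrightarrow> 0 < k i"
      and ev: "eventually (\<lambda>t. 0 < t \<and> t < 1 \<and> (\<forall>i\<in>{1..N}. \<rho> i (inward_ray c p t) powr (- \<alpha> i)
       \<le> k i * (if p \<in> H i then t powr (- \<alpha> i) else 1))) (at_right 0)"
      using \<rho>_powr_inward_ray_le[OF c] by blast
    have "eventually (\<lambda>t. (\<Prod>i=1..N. \<rho> i (inward_ray c p t) powr (- \<alpha> i))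
        \<le> (\<Prod>i=1..N. k i) * t powr (- (\<Sum>i\<in>I. \<alpha> i))) (at_right 0)"
      using ev
    proof eventually_elim
      case (elim t)
      have "(\<Prod>i=1..N. \<rho> i (inward_ray c p t) powr (- \<alpha> i))
          \<le> (\<Prod>i=1..N. k i * (if i \<in> I then t powr (- \<alpha> i) else 1))"
        using elim pD(3) by (intro prod_mono) auto
      also have "\<dots> = (\<Prod>i=1..N. k i) * (\<Prod>i\<in>I. t powr (- \<alpha> i))"
        using pD(2) by (simp add: prod.distrib prod.If_cases Int_absorb1)
      also have "(\<Prod>i\<in>I. t powr (- \<alpha> i)) = t powr (- (\<Sum>i\<in>I. \<alpha> i))"
        using elim pD(2) finite_subset[OF pD(2)] by (simp add: powr_sum[symmetric] sum_negf)
      finally show ?case .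
    qed
    moreover have "0 \<le> (\<Prod>i=1..N. k i)" using k by (intro prod_nonneg) (auto intro: less_imp_le)
    ultimately show "accessible_point X A (product_metric N \<rho> \<alpha> g) p"
      unfolding product_metric_def by (intro accessible_pointI[OF c s])
  qed
qed

lemma sum_accessible_iff:
  assumes I: "I \<noteq> {}" and ne: "open_face X N H I \<noteq> {}"
  shows "accessible X A (sum_metric N \<rho> \<alpha> g) (open_face X N H I) \<longleftrightarrow> Max (\<alpha> ` I) < 2"
proof
  assume acc: "accessible X A (sum_metric N \<rho> \<alpha> g) (open_face X N H I)"
  obtain p where p: "p \<in> open_face X N H I" using ne by blast
  note pD = open_faceD[OF p]
  have fin: "finite I" by (rule finite_subset[OF pD(2) finite_atLeastAtMost])
  have "\<alpha> i < 2" if i: "i \<in> I" for i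
  proof (rule ccontr)
    assume "\<not> \<alpha> i < 2"
    then have "\<not> accessible_point X A (sum_metric N \<rho> \<alpha> g) p"
      unfolding sum_metric_def
    \<comment> \<open>The single \<open>\<rho> i\<close> with a large exponent already makes the sum
      too large.\<close>
    proof (intro inaccessibleI[of "{i}" "{i}"])
      fix q assume "q \<in> mfd_interior X A"
      have "\<rho> i q powr (- \<alpha> i) \<le> (\<Sum>i=1..N. \<rho> i q powr (- \<alpha> i))"
        using i pD(2) by (intro member_le_sum) auto
      then show "(\<Prod>i\<in>{i}. \<rho> i q powr (- \<alpha> i)) \<le> (\<Sum>i=1..N. \<rho> i q powr (- \<alpha> i))" by simp
    qed (use i pD in auto)
    with acc p show False by (auto simp: accessible_def)
  qed
  then show "Max (\<alpha> ` I) < 2" using fin I by simp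
next
  assume s: "Max (\<alpha> ` I) < 2"
  show "accessible X A (sum_metric N \<rho> \<alpha> g) (open_face X N H I)"
    unfolding accessible_def
  proof
    fix p assume p: "p \<in> open_face X N H I"
    note pD = open_faceD[OF p]
    have fin: "finite I" by (rule finite_subset[OF pD(2) finite_atLeastAtMost])
    have \<alpha>M: "\<alpha> i \<le> Max (\<alpha> ` I)" if "i \<in> I" for i using fin that by simp
    have M0: "0 \<le> Max (\<alpha> ` I)" using \<alpha>M I hypersurface(3) pD(2) by (metis all_not_in_conv order_trans subsetD)
    obtain c where c: "c \<in> A" "p \<in> chart_dom c" using ex_chart[OF pD(1)] by blast
    obtain k where k: "\<And>i. i \<in> {1..N} \<Longrightarrow> 0 < k i"
      and ev: "eventually (\<lambda>t. 0 < t \<and> t < 1 \<and> (\<forall>i\<in>{1..N}. \<rho> i (inward_ray c p t) powr (- \<alpha> i)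
       \<le> k i * (if p \<in> H i then t powr (- \<alpha> i) else 1))) (at_right 0)"
      using \<rho>_powr_inward_ray_le[OF c] by blast
    have "eventually (\<lambda>t. (\<Sum>i=1..N. \<rho> i (inward_ray c p t) powr (- \<alpha> i))
        \<le> (\<Sum>i=1..N. k i) * t powr (- Max (\<alpha> ` I))) (at_right 0)"
      using ev
    proof eventually_elim
      case (elim t)
      have "\<rho> i (inward_ray c p t) powr (- \<alpha> i) \<le> k i * t powr (- Max (\<alpha> ` I))" if i: "i \<in> {1..N}" for i
      proof -
        have "(if p \<in> H i then t powr (- \<alpha> i) else 1) \<le> t powr (- Max (\<alpha> ` I))"
          using elim \<alpha>M M0 pD(3)[OF i] powr_mono'[of "- Max (\<alpha> ` I)" 0 t] by (auto intro: powr_mono')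
        then have "k i * (if p \<in> H i then t powr (- \<alpha> i) else 1) \<le> k i * t powr (- Max (\<alpha> ` I))"
          using k[OF i] by (intro mult_left_mono) auto
        with elim i show ?thesis by fastforce
      qed
      then show ?case unfolding sum_distrib_right by (rule sum_mono)
    qed
    moreover have "0 \<le> (\<Sum>i=1..N. k i)" using k by (intro sum_nonneg) (auto intro: less_imp_le)
    ultimately show "accessible_point X A (sum_metric N \<rho> \<alpha> g) p"
      unfolding sum_metric_def by (intro accessible_pointI[OF c s])
  qed
qed

end

section \<open>The unit square\<close>

lemma Ck_on_const: "Ck_on k (\<lambda>_. c) U"
  by (induction k arbitrary: c) (auto simp: frechet_derivative_const)

text \<open>The derivative in any fixed direction is constant, so all higher conditions concern
  constant functions.\<close>

lemma Ck_on_affine: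
  assumes "bounded_linear L"
  shows "Ck_on k (\<lambda>x. a + L x) U"
proof (cases k)
  case 0
  then show ?thesis using linear_continuous_on[OF assms] by (simp add: continuous_on_add)
next
  case (Suc m)
  have D: "((\<lambda>x. a + L x) has_derivative L) (at x)" for x
    using bounded_linear_imp_has_derivative[OF assms] by (auto intro!: derivative_eq_intros)
  then have "frechet_derivative (\<lambda>x. a + L x) (at x) = L" for x
    using frechet_derivative_at by metis
  with Suc D show ?thesis by (auto simp: differentiable_def Ck_on_const)
qed

lemma smooth_within_affine:
  assumes "bounded_linear L" "\<And>x. x \<in> S \<Longrightarrow> f x = a + L x"
  shows "smooth_within f S"
  unfolding smooth_within_def
  using assms by (intro ballI exI[of _ UNIV] exI[of _ "\<lambda>x. a + L x"]) (auto simp: Ck_on_affine)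

lemma second_countable_euclidean:
  "second_countable (euclidean :: 'a::second_countable_topology topology)"
proof -
  obtain B :: "'a set set" where B: "countable B" "topological_basis B"
    using ex_countable_basis by blast
  then show ?thesis
    unfolding second_countable_def
    by (intro exI[of _ B]) (auto simp: topological_basis_open elim!: topological_basisE)
qed

text \<open>The complement of a cell is the union of the other open cells, so every cell is clopen.
  A component meeting it cannot leave it, and contains it because the cell is connected.\<close>

lemma connected_components_of_partition:
  assumes cover: "topspace X = \<Union>\<C>"
    and C: "\<And>C. C \<in> \<C> \<Longrightarrow> C \<noteq> {} \<and> openin X C \<and> connectedin X C"
    and disj: "pairwise disjnt \<C>"
  shows "connected_components_of X = \<C>"
proof -
  have comp: "connected_component_of_set X x = C" if x: "x \<in> C" "C \<in> \<C>" for x C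
  proof
    show "C \<subseteq> connected_component_of_set X x"
      using C[OF x(2)] x(1) by (intro connected_component_of_maximal) auto
    have "openin X (\<Union>(\<C> - {C}))" using C by (intro openin_Union) auto
    moreover have "topspace X - C = \<Union>(\<C> - {C})"
      using cover disj x(2) by (fastforce simp: pairwise_def disjnt_def)
    moreover have "C \<subseteq> topspace X" using cover x by auto
    ultimately have "closedin X C" by (simp add: closedin_def)
    then have "connected_component_of_set X x \<subseteq> C \<or> disjnt (connected_component_of_set X x) C"
      by (rule connectedin_clopen_cases[OF connectedin_connected_component_of]) (simp add: C[OF x(2)])
    moreover have "x \<in> connected_component_of_set X x"
      using x cover by (auto simp: connected_component_of_refl)
    ultimately show "connected_component_of_set X x \<subseteq> C" using x by (auto simp: disjnt_def)
  qed
  show ?thesis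
    unfolding connected_components_of_def cover
  proof (intro equalityI subsetI)
    fix K assume "K \<in> connected_component_of_set X ` \<Union>\<C>"
    then show "K \<in> \<C>" using comp by auto
  next
    fix K assume K: "K \<in> \<C>"
    then obtain x where "x \<in> K" using C by blast
    then show "K \<in> connected_component_of_set X ` \<Union>\<C>" using comp K by blast
  qed
qed

section \<open>Charts, smooth structure and flat metric of the square\<close>

lemma Basis_real_vec: "(Basis :: (real^'n) set) = range (\<lambda>i. axis i 1)"
  by (auto simp: Basis_vec_def)

definition unit_square :: "(real^2) set" where
  "unit_square = {x. \<forall>i. 0 \<le> x $ i \<and> x $ i \<le> 1}"

text \<open>The four charts reflect the square so that the corner with coordinates \<open>1\<close> exactly on \<open>S\<close>
  becomes the origin.\<close>

definition flip :: "2 set \<Rightarrow> real^2 \<Rightarrow> real^2" where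
  "flip S x = (\<chi> i. if i \<in> S then 1 - x $ i else x $ i)"

definition square_chart :: "2 set \<Rightarrow> (real^2, real^2) chart" where
  "square_chart S = \<lparr>chart_dom = {x \<in> unit_square. \<forall>i. flip S x $ i < 1},
     chart_corner = Basis, chart_map = flip S\<rparr>"

abbreviation square_atlas :: "(real^2, real^2) chart set" where
  "square_atlas \<equiv> range square_chart"

text \<open>The common image of all four charts. Omitting the sides where a coordinate is
  \<open>1\<close> makes it relatively open in the quadrant.\<close>

definition half_open_square :: "(real^2) set" where
  "half_open_square = {x. \<forall>i. 0 \<le> x $ i \<and> x $ i < 1}"

lemma flip_nth: "flip S x $ i = (if i \<in> S then 1 - x $ i else x $ i)"
  by (simp add: flip_def)

lemma flip_flip [simp]: "flip S (flip S x) = x"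
  by (simp add: vec_eq_iff flip_nth)

lemma bounded_linear_signs: "bounded_linear (\<lambda>x. \<chi> i. \<sigma> i * x $ i :: real^'n)"
  unfolding linear_conv_bounded_linear[symmetric]
  by (rule linearI) (simp_all add: vec_eq_iff algebra_simps)

lemma continuous_on_flip: "continuous_on S (flip T)"
  unfolding flip_def
proof (rule continuous_on_vec_lambda)
  show "continuous_on S (\<lambda>x. if i \<in> T then 1 - x $ i else x $ i)" for i
    by (cases "i \<in> T") (auto intro!: continuous_intros)
qed

lemma square_chart_sel [simp]:
  "chart_dom (square_chart S) = {x \<in> unit_square. \<forall>i. flip S x $ i < 1}"
  "chart_corner (square_chart S) = Basis" "chart_map (square_chart S) = flip S"
  by (simp_all add: square_chart_def)

lemma square_chart_dom: "x \<in> chart_dom (square_chart S) \<longleftrightarrow> flip S x \<in> half_open_square"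
proof -
  have *: "0 \<le> x $ i \<and> x $ i \<le> 1 \<and> flip S x $ i < 1 \<longleftrightarrow> 0 \<le> flip S x $ i \<and> flip S x $ i < 1" for i
    by (auto simp: flip_nth)
  have "x \<in> chart_dom (square_chart S) \<longleftrightarrow> (\<forall>i. 0 \<le> x $ i \<and> x $ i \<le> 1 \<and> flip S x $ i < 1)"
    by (auto simp: unit_square_def)
  then show ?thesis unfolding * by (simp add: half_open_square_def)
qed

lemma square_chart_image: "chart_image (square_chart S) = half_open_square"
proof (intro equalityI subsetI)
  fix y assume "y \<in> half_open_square"
  then have "flip S y \<in> chart_dom (square_chart S)" by (simp only: square_chart_dom flip_flip)
  then show "y \<in> chart_image (square_chart S)"
    unfolding chart_image_def by (intro image_eqI[of _ _ "flip S y"]) simp_all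
qed (use square_chart_dom in \<open>auto simp: chart_image_def simp del: square_chart_sel(1)\<close>)

lemma square_chart_inv:
  assumes "y \<in> half_open_square"
  shows "chart_inv (square_chart S) y = flip S y"
proof -
  have "inj_on (flip S) (chart_dom (square_chart S))" by (metis flip_flip inj_onI)
  moreover have "flip S y \<in> chart_dom (square_chart S)" using assms by (simp only: square_chart_dom flip_flip)
  ultimately have "inv_into (chart_dom (square_chart S)) (flip S) (flip S (flip S y)) = flip S y"
    by (rule inv_into_f_f)
  then show ?thesis by (simp add: chart_inv_def)
qed

lemma open_strip: "open {x::real^2. \<forall>i. f i x < g i x}"
  if "\<And>i. continuous_on UNIV (f i)" "\<And>i. continuous_on UNIV (g i)"
  for f g :: "2 \<Rightarrow> real^2 \<Rightarrow> real"
  unfolding forall_2 by (intro open_Collect_conj open_Collect_less that)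

lemma is_chart_square: "is_chart (top_of_set unit_square) (square_chart S)"
proof -
  let ?D = "chart_dom (square_chart S)"
  have 1: "openin (top_of_set unit_square) ?D"
  proof -
    have "open {x. \<forall>i. flip S x $ i < 1}"
      by (intro open_strip continuous_intros continuous_on_flip)
    moreover have "?D = unit_square \<inter> {x. \<forall>i. flip S x $ i < 1}" by auto
    ultimately show ?thesis by (metis openin_open_Int)
  qed
  have "open {x::real^2. \<forall>i. x $ i < 1}" by (intro open_strip continuous_intros)
  moreover have "half_open_square = corner_model Basis \<inter> {x. \<forall>i. x $ i < 1}"
    by (auto simp: half_open_square_def corner_model_def Basis_real_vec inner_axis)
  ultimately have 2: "openin (top_of_set (corner_model Basis)) half_open_square"
    by (metis openin_open_Int)
  have "subtopology (top_of_set unit_square) ?D = top_of_set ?D"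
    by (auto simp: subtopology_subtopology intro!: arg_cong[of _ _ top_of_set])
  moreover have "homeomorphic_maps (top_of_set ?D) (top_of_set half_open_square) (flip S) (flip S)"
    unfolding homeomorphic_maps_def
    using square_chart_dom[of _ S] square_chart_dom[of "flip S _" S]
    by (auto simp: continuous_map_in_subtopology continuous_on_flip simp del: square_chart_sel(1))
  ultimately show ?thesis
    using 1 2 unfolding is_chart_def square_chart_image
    by (auto simp: homeomorphic_map_maps simp del: square_chart_sel(1))
qed

lemma square_overlap:
  "flip S ` (chart_dom (square_chart S) \<inter> chart_dom (square_chart S'))
     = {y \<in> half_open_square. flip S' (flip S y) \<in> half_open_square}" (is "?L = ?R")
proof (intro equalityI subsetI)
  fix y assume "y \<in> ?R"
  then have "flip S y \<in> chart_dom (square_chart S) \<inter> chart_dom (square_chart S')"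
    by (simp only: Int_iff square_chart_dom flip_flip mem_Collect_eq)
  then show "y \<in> ?L" by (intro image_eqI[of _ _ "flip S y"]) simp_all
qed (use square_chart_dom in \<open>auto simp del: square_chart_sel(1)\<close>)

text \<open>Coordinates on which \<open>S\<close> and \<open>S'\<close> agree are unchanged and the
  others are replaced by one minus themselves, so the transition is affine with a diagonal matrix of
  signs as linear part.\<close>

lemma square_transition:
  fixes S S' :: "2 set"
  defines "\<sigma> \<equiv> \<lambda>i. if (i \<in> S) = (i \<in> S') then 1 else - 1 :: real"
  assumes "y \<in> half_open_square"
  shows "(chart_map (square_chart S') \<circ> chart_inv (square_chart S)) y = flip S' (flip S 0) + (\<chi> i. \<sigma> i * y $ i)"
  using assms by (simp add: square_chart_inv vec_eq_iff flip_nth \<sigma>_def)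

text \<open>Flipping exactly the coordinates above one half brings all of them to at most one
  half.\<close>

lemma ex_square_chart: "x \<in> unit_square \<Longrightarrow> \<exists>S. x \<in> chart_dom (square_chart S)"
  by (intro exI[of _ "{i. x $ i > 1/2}"]) (auto simp: flip_nth)

lemma manifold_square: "manifold_with_corners (top_of_set unit_square) square_atlas"
proof -
  have "(\<Union>c\<in>square_atlas. chart_dom c) = topspace (top_of_set unit_square)"
    using ex_square_chart by auto
  moreover have "smooth_transition (square_chart S) (square_chart S')" for S S'
    unfolding smooth_transition_def square_chart_sel(3) square_overlap
    by (rule smooth_within_affine[OF bounded_linear_signs])
      (use square_transition[of _ S' S] in simp)
  moreover have "Hausdorff_space (top_of_set unit_square)"
    by (intro Hausdorff_space_subtopology Hausdorff_space_euclidean)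
  moreover have "second_countable (top_of_set unit_square)"
    by (intro second_countable_subtopology second_countable_euclidean)
  ultimately show ?thesis
    by (auto simp: manifold_with_corners_def is_chart_square simp del: square_chart_sel)
qed

text \<open>The Euclidean inner product in every chart is consistent because the transitions have
  sign matrices as derivatives, which preserve it. The law quantifies over every derivative within
  the overlap, so uniqueness of that derivative has to be shown, also at boundary points.\<close>

lemma riemannian_square: "riemannian_metric square_atlas (\<lambda>c p u v. u \<bullet> v)"
proof -
  have bil: "bilinear ((\<bullet>) :: real^2 \<Rightarrow> _)"
    using bounded_bilinear_inner by (simp add: bilinear_conv_bounded_bilinear)
  have law: "u \<bullet> v = D u \<bullet> D v"
    if p: "p \<in> chart_dom (square_chart S) \<inter> chart_dom (square_chart S')"
      and D: "((chart_map (square_chart S') \<circ> chart_inv (square_chart S)) has_derivative D)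
          (at (chart_map (square_chart S) p) within
             chart_map (square_chart S) ` (chart_dom (square_chart S) \<inter> chart_dom (square_chart S')))"
    for S S' p D and u v :: "real^2"
  proof -
    define \<sigma> where "\<sigma> i = (if (i \<in> S) = (i \<in> S') then 1 else - 1 :: real)" for i
    define Z where "Z = {y \<in> half_open_square. flip S' (flip S y) \<in> half_open_square}"
    define x where "x = flip S p"
    have x: "x \<in> Z" using p unfolding Int_iff square_chart_dom by (simp add: Z_def x_def)
    define L :: "real^2 \<Rightarrow> real^2" where "L y = (\<chi> i. \<sigma> i * y $ i)" for y
    have L: "bounded_linear L" unfolding L_def by (rule bounded_linear_signs)
    have "((\<lambda>y. flip S' (flip S 0) + L y) has_derivative L) (at x within Z)"
      using bounded_linear_imp_has_derivative[OF L] by (auto intro!: derivative_eq_intros)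
    moreover have "((\<lambda>y. flip S' (flip S 0) + L y) has_derivative D) (at x within Z)"
    proof (rule has_derivative_transform[OF x])
      show "((chart_map (square_chart S') \<circ> chart_inv (square_chart S)) has_derivative D) (at x within Z)"
        using D unfolding square_chart_sel(3) square_overlap Z_def x_def .
    qed (use square_transition[of _ S' S] in \<open>auto simp: Z_def L_def \<sigma>_def\<close>)
    \<comment> \<open>The criterion for a unique derivative within \<open>Z\<close>: arbitrarily
      short steps along every basis direction stay in \<open>Z\<close>. Positive steps work, because
      the upper bound on each coordinate is strict.\<close>
    moreover have "\<exists>d. 0 < \<bar>d\<bar> \<and> \<bar>d\<bar> < e \<and> x + d *\<^sub>R b \<in> Z" if "b \<in> Basis" "0 < e" for b e
    proof -
      obtain i where b: "b = axis i 1" using \<open>b \<in> Basis\<close> by (auto simp: Basis_real_vec)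
      have x1: "x $ i < 1" "0 \<le> x $ j" "x $ j < 1" "flip S' (flip S x) $ j < 1" for j
        using x by (auto simp: Z_def half_open_square_def)
      \<comment> \<open>Keeping \<open>x $ i + d\<close> below \<open>1\<close> handles both a
        coordinate and its reflection.\<close>
      define d where "d = min (e / 2) ((1 - x $ i) / 2)"
      have d: "0 < d" "d < e" "x $ i + d < 1" using x1 \<open>0 < e\<close> by (auto simp: d_def min_def field_simps)
      have n: "(x + d *\<^sub>R b) $ j = (if j = i then x $ j + d else x $ j)" for j
        by (simp add: b axis_def)
      have "x + d *\<^sub>R b \<in> Z"
      proof -
        have "0 \<le> (x + d *\<^sub>R b) $ j \<and> (x + d *\<^sub>R b) $ j < 1" for j
          using x1(2,3)[of j] d unfolding n by auto
        moreover have "0 \<le> flip S' (flip S (x + d *\<^sub>R b)) $ j \<and> flip S' (flip S (x + d *\<^sub>R b)) $ j < 1" for j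
          using x1(2-4)[of j] d unfolding flip_nth n by (auto split: if_splits)
        ultimately show ?thesis by (simp add: Z_def half_open_square_def)
      qed
      with d show ?thesis by (intro exI[of _ d]) auto
    qed
    ultimately have "L = D" by (rule frechet_derivative_unique_within)
    moreover have "L u \<bullet> L v = u \<bullet> v"
      unfolding inner_vec_def by (intro sum.cong) (auto simp: L_def \<sigma>_def)
    ultimately show ?thesis by simp
  qed
  show ?thesis
    unfolding riemannian_metric_def
  proof (intro conjI ballI allI impI)
    fix c :: "(real^2, real^2) chart" and u v :: "real^2"
    show "smooth_within (\<lambda>x. u \<bullet> v) (chart_image c)"
      by (rule smooth_within_affine[OF bounded_linear_zero, of _ _ "u \<bullet> v"]) simp
  next
    fix c c' :: "(real^2, real^2) chart" and p D and u v :: "real^2"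
    assume "c \<in> square_atlas" "c' \<in> square_atlas" and p: "p \<in> chart_dom c \<inter> chart_dom c'"
      and D: "((chart_map c' \<circ> chart_inv c) has_derivative D)
          (at (chart_map c p) within chart_map c ` (chart_dom c \<inter> chart_dom c'))"
    then obtain S S' where S: "c = square_chart S" "c' = square_chart S'" by blast
    show "u \<bullet> v = D u \<bullet> D v" by (rule law[OF p[unfolded S] D[unfolded S]])
  qed (simp_all add: bil inner_commute)
qed

section \<open>The edges as boundary hypersurfaces\<close>

definition edge_index :: "nat \<Rightarrow> 2" where
  "edge_index k = (if k = 1 \<or> k = 3 then 1 else 2)"

definition edge_value :: "nat \<Rightarrow> real" where
  "edge_value k = (if k \<le> 2 then 0 else 1)"

text \<open>Edges \<open>1\<close> and \<open>2\<close> lie on the coordinate axes and meet at the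
  origin; edges \<open>3\<close> and \<open>4\<close> are opposite to them in this order.\<close>

definition edge :: "nat \<Rightarrow> (real^2) set" where
  "edge k = {x \<in> unit_square. x $ edge_index k = edge_value k}"

definition open_edge :: "nat \<Rightarrow> (real^2) set" where
  "open_edge k = {x. x $ edge_index k = edge_value k \<and>
     (\<forall>j. j \<noteq> edge_index k \<longrightarrow> 0 < x $ j \<and> x $ j < 1)}"

text \<open>The absolute value covers both a coordinate and its reflection. On the square its
  argument has constant sign, so the function is affine in each chart.\<close>

definition edge_dist :: "nat \<Rightarrow> real^2 \<Rightarrow> real" where
  "edge_dist k x = \<bar>x $ edge_index k - edge_value k\<bar>"

lemma edge_cases: "edge_value k = 0 \<or> edge_value k = 1"
  by (simp add: edge_value_def)

lemma edge_eqI: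
  assumes "k \<in> {1..4}" "l \<in> {1..4}" "edge_index k = edge_index l" "edge_value k = edge_value l"
  shows "k = l"
proof -
  have "k \<in> {1,2,3,4}" "l \<in> {1,2,3,4}" using assms(1,2) by auto
  then show ?thesis using assms(3,4) by (auto simp: edge_index_def edge_value_def)
qed

lemma ex_edge:
  assumes "v = 0 \<or> v = 1"
  shows "\<exists>k\<in>{1..4}. edge_index k = i \<and> edge_value k = v"
proof -
  have "i = 1 \<or> i = 2" by (rule exhaust_2)
  then show ?thesis
    using assms by (elim disjE) (force simp: edge_index_def edge_value_def intro: bexI[of _ 1] bexI[of _ 2]
       bexI[of _ 3] bexI[of _ 4])+
qed

lemma open_edge_subset: "open_edge k \<subseteq> edge k"
proof
  fix x assume x: "x \<in> open_edge k"
  have "0 \<le> x $ j \<and> x $ j \<le> 1" for j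
    using x edge_cases[of k] by (cases "j = edge_index k") (auto simp: open_edge_def less_imp_le)
  then show "x \<in> edge k" using x by (simp add: edge_def open_edge_def unit_square_def)
qed

text \<open>A chart domain omits the points whose flipped coordinate is \<open>1\<close>, so within
  it a flipped coordinate vanishes exactly when the original one is \<open>0\<close> or
  \<open>1\<close>.\<close>

lemma square_depth_stratum:
  "depth_stratum (top_of_set unit_square) square_atlas m
     = {p \<in> unit_square. card {i. p $ i = 0 \<or> p $ i = 1} = m}"
proof -
  have *: "card {b \<in> Basis. flip S p \<bullet> b = 0} = card {i. p $ i = 0 \<or> p $ i = 1}"
    if p: "p \<in> chart_dom (square_chart S)" for S and p :: "real^2"
  proof -
    have "{b \<in> Basis. flip S p \<bullet> b = 0} = (\<lambda>i. axis i 1) ` {i. flip S p $ i = 0}"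
      by (auto simp: Basis_real_vec inner_axis)
    moreover have "{i. flip S p $ i = 0} = {i. p $ i = 0 \<or> p $ i = 1}"
    proof -
      have "flip S p $ i = 0 \<longleftrightarrow> p $ i = 0 \<or> p $ i = 1" for i
        using p by (auto simp: flip_nth dest!: spec[of _ i])
      then show ?thesis by simp
    qed
    moreover have "inj (\<lambda>i::2. axis i (1::real))" by (simp add: inj_def axis_eq_axis)
    ultimately show ?thesis by (simp add: card_image inj_on_subset)
  qed
  show ?thesis
    unfolding depth_stratum_def
  proof (intro Collect_cong iffI conjI; elim conjE bexE)
    fix p c assume "c \<in> square_atlas" and p: "p \<in> chart_dom c" "card {b \<in> chart_corner c. chart_map c p \<bullet> b = 0} = m"
    then obtain S where "c = square_chart S" by blast
    with p *[of p S] show "card {i. p $ i = 0 \<or> p $ i = 1} = m" by simp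
  next
    fix p :: "real^2" assume p: "p \<in> unit_square" "card {i. p $ i = 0 \<or> p $ i = 1} = m"
    obtain S where "p \<in> chart_dom (square_chart S)" using ex_square_chart p(1) by blast
    with p(2) * show "\<exists>c\<in>square_atlas. p \<in> chart_dom c \<and> card {b \<in> chart_corner c. chart_map c p \<bullet> b = 0} = m"
      by (intro bexI[of _ "square_chart S"]) auto
  qed simp_all
qed

lemma square_stratum_1:
  "depth_stratum (top_of_set unit_square) square_atlas 1 = (\<Union>k\<in>{1..4}. open_edge k)"
proof (intro equalityI subsetI)
  fix p assume "p \<in> depth_stratum (top_of_set unit_square) square_atlas 1"
  then have p: "p \<in> unit_square" and "card {i. p $ i = 0 \<or> p $ i = 1} = 1"
    by (auto simp: square_depth_stratum)
  then obtain i where i: "{i. p $ i = 0 \<or> p $ i = 1} = {i}" by (metis card_1_singletonE)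
  then have "p $ i = 0 \<or> p $ i = 1" by blast
  then obtain k where k: "k \<in> {1..4}" "edge_index k = i" "edge_value k = p $ i"
    using ex_edge by blast
  have "0 < p $ j \<and> p $ j < 1" if "j \<noteq> i" for j
  proof -
    have "p $ j \<noteq> 0" "p $ j \<noteq> 1" using i that by auto
    then show ?thesis using p by (auto simp: unit_square_def less_le)
  qed
  then have "p \<in> open_edge k" using k(2,3) by (simp add: open_edge_def)
  with k(1) show "p \<in> (\<Union>k\<in>{1..4}. open_edge k)" by blast
next
  fix p assume "p \<in> (\<Union>k\<in>{1..4}. open_edge k)"
  then obtain k where p: "p \<in> open_edge k" by blast
  then have "p \<in> unit_square" using open_edge_subset by (auto simp: edge_def)
  moreover have "{i. p $ i = 0 \<or> p $ i = 1} = {edge_index k}"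
    using p edge_cases[of k] unfolding open_edge_def by force
  ultimately show "p \<in> depth_stratum (top_of_set unit_square) square_atlas 1"
    by (simp add: square_depth_stratum)
qed

lemma open_edge_convex: "convex (open_edge k)"
proof -
  have "convex {x::real^2. x $ edge_index k = edge_value k}"
    using convex_hyperplane[of "axis (edge_index k) (1::real)" "edge_value k"] by (simp add: inner_axis' )
  moreover have "convex {x::real^2. 0 < x $ j \<and> x $ j < 1}" for j
    using convex_Int[OF convex_halfspace_gt[of 0 "axis j (1::real)"] convex_halfspace_lt[of "axis j (1::real)" 1]]
    by (simp add: inner_axis' Collect_conj_eq[symmetric])
  moreover have "open_edge k = {x. x $ edge_index k = edge_value k} \<inter>
      (\<Inter>j\<in>-{edge_index k}. {x. 0 < x $ j \<and> x $ j < 1})"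
    by (auto simp: open_edge_def)
  ultimately show ?thesis by (auto intro!: convex_Int convex_INT)
qed

text \<open>Witnesses that the open edge is nonempty, serves as the centre of contraction in the
  closure, and tells the edges apart.\<close>

definition edge_midpoint :: "nat \<Rightarrow> real^2" where
  "edge_midpoint k = (\<chi> j. if j = edge_index k then edge_value k else 1 / 2)"

lemma edge_midpoint: "edge_midpoint k \<in> open_edge k"
  by (simp add: edge_midpoint_def open_edge_def)

lemma square_components:
  "connected_components_of (subtopology (top_of_set unit_square)
     (depth_stratum (top_of_set unit_square) square_atlas 1)) = open_edge ` {1..4}"
proof -
  define D where "D = (\<Union>k\<in>{1..4}. open_edge k)"
  have D: "D \<subseteq> unit_square" using open_edge_subset by (auto simp: D_def edge_def)
  then have top: "subtopology (top_of_set unit_square) D = top_of_set D"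
    by (simp add: subtopology_subtopology Int_absorb1)
  \<comment> \<open>The point lies on some open edge \<open>l\<close>. The strict bounds force
    \<open>l\<close> to constrain the same coordinate as \<open>k\<close>, and the excluded value
    rules out the opposite side.\<close>
  have other: "x \<in> open_edge k" if x: "x \<in> D" "x $ edge_index k \<noteq> 1 - edge_value k"
    "\<And>j. j \<noteq> edge_index k \<Longrightarrow> 0 < x $ j \<and> x $ j < 1" for x k
  proof -
    obtain l where l: "x \<in> open_edge l" using x(1) by (auto simp: D_def)
    have xl: "x $ edge_index l = edge_value l" using l by (simp add: open_edge_def)
    then have "edge_index l = edge_index k"
      using x(3)[of "edge_index l"] edge_cases[of l] by force
    then have "x $ edge_index k = edge_value k"
      using xl x(2) edge_cases[of l] edge_cases[of k] by auto
    with x(3) show ?thesis by (simp add: open_edge_def)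
  qed
  have op: "openin (top_of_set D) (open_edge k)" if k: "k \<in> {1..4}" for k
  proof -
    \<comment> \<open>The first set removes the opposite edge; the other two place the free
      coordinate strictly between \<open>0\<close> and \<open>1\<close>. At the constrained index
      they read \<open>0 < 1\<close>, which makes them vacuous there.\<close>
    define U where "U = {x::real^2. x $ edge_index k \<noteq> 1 - edge_value k} \<inter>
      {x. \<forall>j. (if j = edge_index k then 0 else - x $ j) < (if j = edge_index k then 1 else 0)} \<inter>
      {x. \<forall>j. (if j = edge_index k then 0 else x $ j) < 1}"
    have "open U"
      unfolding U_def
    proof (intro open_Int open_strip)
      show "open {x::real^2. x $ edge_index k \<noteq> 1 - edge_value k}"
        by (intro open_Collect_neq continuous_intros)
      show "continuous_on UNIV (\<lambda>x::real^2. if j = edge_index k then 0 else - x $ j)" for j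
        by (cases "j = edge_index k") (auto intro!: continuous_intros)
      show "continuous_on UNIV (\<lambda>x::real^2. if j = edge_index k then 0 else x $ j)" for j
        by (cases "j = edge_index k") (auto intro!: continuous_intros)
    qed (auto intro!: continuous_intros)
    moreover have "open_edge k = D \<inter> U"
    proof (intro equalityI subsetI)
      fix x assume x: "x \<in> open_edge k"
      then show "x \<in> D \<inter> U" using k edge_cases[of k] by (auto simp: D_def U_def open_edge_def)
    next
      fix x assume x: "x \<in> D \<inter> U"
      have "0 < x $ j \<and> x $ j < 1" if "j \<noteq> edge_index k" for j
        using x that unfolding U_def by (auto dest!: spec[of _ j])
      with x show "x \<in> open_edge k" by (intro other) (auto simp: U_def)
    qed
    ultimately show ?thesis by (metis openin_open_Int)
  qed
  have "connected_components_of (top_of_set D) = open_edge ` {1..4}"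
  proof (rule connected_components_of_partition)
    show "topspace (top_of_set D) = \<Union>(open_edge ` {1..4})" by (simp add: D_def)
    fix C assume "C \<in> open_edge ` {1..4}"
    then obtain k where k: "k \<in> {1..4}" "C = open_edge k" by blast
    have "C \<subseteq> D" using k by (auto simp: D_def)
    moreover have "connected C" using open_edge_convex k by (simp add: convex_connected)
    ultimately show "C \<noteq> {} \<and> openin (top_of_set D) C \<and> connectedin (top_of_set D) C"
      using op k edge_midpoint[of k] by (auto simp: connectedin_subtopology)
  next
    show "pairwise disjnt (open_edge ` {1..4})"
    proof (rule pairwiseI)
      fix C C' assume "C \<in> open_edge ` {1..4}" "C' \<in> open_edge ` {1..4}" "C \<noteq> C'"
      then obtain k l where kl: "k \<in> {1..4}" "l \<in> {1..4}" "C = open_edge k" "C' = open_edge l" "k \<noteq> l"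
        by blast
      have False if x: "x \<in> open_edge k" "x \<in> open_edge l" for x
      proof -
        have "x $ edge_index k = edge_value k" "x $ edge_index l = edge_value l"
          using x by (auto simp: open_edge_def)
        moreover from this have "edge_index k = edge_index l"
          using x(2) edge_cases[of k] unfolding open_edge_def by force
        ultimately show False using edge_eqI[OF kl(1,2)] kl(5) by simp
      qed
      then show "disjnt C C'" using kl by (auto simp: disjnt_def)
    qed
  qed
  then show ?thesis unfolding square_stratum_1 D_def[symmetric] top .
qed

text \<open>Contracting a point of the edge slightly towards the midpoint moves the free coordinate
  strictly between \<open>0\<close> and \<open>1\<close>; conversely the edge is closed.\<close>

lemma closure_open_edge: "top_of_set unit_square closure_of (open_edge k) = edge k"
proof -
  have sub: "open_edge k \<subseteq> unit_square" using open_edge_subset by (auto simp: edge_def)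
  have "closed (edge k)"
  proof -
    have "edge k = (\<Inter>i. {x. 0 \<le> x $ i} \<inter> {x. x $ i \<le> 1}) \<inter> {x. x $ edge_index k = edge_value k}"
      by (auto simp: edge_def unit_square_def)
    then show ?thesis
      by (auto intro!: closed_Int closed_INT closed_Collect_le closed_Collect_eq continuous_intros)
  qed
  then have "closure (open_edge k) \<subseteq> edge k" by (rule closure_minimal[OF open_edge_subset])
  moreover have "p \<in> closure (open_edge k)" if p: "p \<in> edge k" for p
  proof -
    define f where "f t = p + t *\<^sub>R (edge_midpoint k - p)" for t :: real
    have "(f \<longlongrightarrow> p) (at_right 0)"
      unfolding f_def by (auto intro!: tendsto_eq_intros)
    moreover have "f t \<in> closure (open_edge k)" if t: "0 < t" "t < 1" for t
    proof -
      have "f t \<in> open_edge k"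
        unfolding open_edge_def
      proof (intro CollectI conjI allI impI)
        show "f t $ edge_index k = edge_value k"
          using p by (simp add: f_def edge_midpoint_def edge_def)
        fix j assume j: "j \<noteq> edge_index k"
        have e: "f t $ j = (1 - t) * p $ j + t / 2"
          using j by (simp add: f_def edge_midpoint_def algebra_simps)
        have "0 \<le> p $ j" "p $ j \<le> 1" using p by (auto simp: edge_def unit_square_def)
        then have "0 \<le> (1 - t) * p $ j" "(1 - t) * p $ j \<le> 1 - t"
          using t by (auto simp: mult_left_le)
        then show "0 < f t $ j" "f t $ j < 1" unfolding e using t by linarith+
      qed
      then show ?thesis using closure_subset by blast
    qed
    then have "eventually (\<lambda>t. f t \<in> closure (open_edge k)) (at_right 0)"
      by (intro eventually_at_rightI[of 0 1]) auto
    ultimately show ?thesis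
      by (intro Lim_in_closed_set[of "closure (open_edge k)" f "at_right 0"]) auto
  qed
  moreover have "edge k \<subseteq> unit_square" by (auto simp: edge_def)
  ultimately show ?thesis
    using sub by (auto simp: closure_of_subtopology Int_absorb1)
qed

lemma square_hypersurfaces:
  "bij_betw edge {1..4} (boundary_hypersurfaces (top_of_set unit_square) square_atlas)"
proof -
  have "inj_on edge {1..4}"
  proof (rule inj_onI)
    fix k l assume kl: "k \<in> {1..4}" "l \<in> {1..4}" "edge k = edge l"
    \<comment> \<open>Its free coordinate is one half, which is no edge value, so \<open>l\<close>
      must constrain the same coordinate to the same value.\<close>
    have "edge_midpoint k \<in> edge l" using edge_midpoint open_edge_subset kl(3) by blast
    then have "(if edge_index l = edge_index k then edge_value k else 1 / 2) = edge_value l"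
      by (simp add: edge_def edge_midpoint_def)
    then show "k = l" using edge_eqI[OF kl(1,2)] edge_cases[of l] by (auto split: if_splits)
  qed
  moreover have "edge ` {1..4} = boundary_hypersurfaces (top_of_set unit_square) square_atlas"
    unfolding boundary_hypersurfaces_def square_components
    by (simp add: image_image closure_open_edge)
  ultimately show ?thesis by (simp add: bij_betw_def)
qed

text \<open>A chart whose domain meets the edge must flip the constrained coordinate exactly when
  the edge value is \<open>1\<close>, as otherwise the flipped coordinate would be the excluded
  value \<open>1\<close>. The whole chart domain then serves as \<open>W\<close>.\<close>

lemma edge_embedded: "embedded_hypersurface (top_of_set unit_square) square_atlas (edge k)"
  unfolding embedded_hypersurface_def
proof (intro ballI)
  fix c p assume c: "c \<in> square_atlas" and p: "p \<in> edge k \<inter> chart_dom c"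
  then obtain S where S: "c = square_chart S" by blast
  have "edge_index k \<in> S \<longleftrightarrow> edge_value k = 1"
    using p edge_cases[of k] by (auto simp: S edge_def flip_nth dest!: spec[of _ "edge_index k"] split: if_splits)
  then have "edge k \<inter> chart_dom c = {q \<in> chart_dom c. chart_map c q \<bullet> axis (edge_index k) 1 = 0}"
    using edge_cases[of k] by (auto simp: S edge_def flip_nth inner_axis)
  moreover have "openin (top_of_set unit_square) (chart_dom c)"
    using is_chart_square[of S] by (simp add: is_chart_def S)
  ultimately show "\<exists>b\<in>chart_corner c. \<exists>W. openin (top_of_set unit_square) W \<and> p \<in> W \<and>
      W \<subseteq> chart_dom c \<and> edge k \<inter> W = {q \<in> W. chart_map c q \<bullet> b = 0}"
    using p by (intro bexI[of _ "axis (edge_index k) 1"] exI[of _ "chart_dom c"])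
      (auto simp: S Basis_real_vec)
qed

text \<open>If the chart places this side at zero, the function is the coordinate itself; otherwise
  the side is missing from the domain and the function is one minus the coordinate.\<close>

lemma edge_dist_chart:
  assumes "y \<in> half_open_square"
  shows "(edge_dist k \<circ> chart_inv (square_chart S)) y =
    (if (edge_index k \<in> S) = (edge_value k = 1) then 0 else 1) +
    (if (edge_index k \<in> S) = (edge_value k = 1) then 1 else - 1) * y $ edge_index k"
  using assms edge_cases[of k] by (auto simp: square_chart_inv edge_dist_def flip_nth half_open_square_def
      abs_if dest: spec[of _ "edge_index k"])

lemma edge_boundary_defining:
  "boundary_defining (top_of_set unit_square) square_atlas (edge k) (edge_dist k)"
proof -
  have lin: "bounded_linear (\<lambda>y::real^2. s * y $ i)" for s i
    by (intro bounded_linear_const_mult bounded_linear_vec_nth)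
  have "smooth_fun square_atlas (edge_dist k)"
    unfolding smooth_fun_def
  proof
    fix c assume "c \<in> square_atlas"
    then obtain S where "c = square_chart S" by blast
    then show "smooth_within (edge_dist k \<circ> chart_inv c) (chart_image c)"
      by (simp only: square_chart_image) (rule smooth_within_affine[OF lin edge_dist_chart])
  qed
  moreover have "differential_nonzero square_atlas (edge_dist k) p" for p
    unfolding differential_nonzero_def
  proof (intro ballI impI)
    fix c assume "c \<in> square_atlas" and p: "p \<in> chart_dom c"
    then obtain S where S: "c = square_chart S" by blast
    \<comment> \<open>The slope is \<open>1\<close> or \<open>- 1\<close>, so the differential is
      nonzero throughout the chart.\<close>
    define s where "s = (if (edge_index k \<in> S) = (edge_value k = 1) then 1 else - 1 :: real)"
    define a where "a = (if (edge_index k \<in> S) = (edge_value k = 1) then 0 else 1 :: real)"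
    have pm: "flip S p \<in> half_open_square" using p square_chart_dom unfolding S by blast
    have "((\<lambda>y. a + s * y $ edge_index k) has_derivative (\<lambda>y. s * y $ edge_index k)) (at (flip S p) within half_open_square)"
      using has_derivative_add[OF has_derivative_const bounded_linear_imp_has_derivative[OF lin[of s "edge_index k"]]]
      by simp
    then have "((edge_dist k \<circ> chart_inv c) has_derivative (\<lambda>y. s * y $ edge_index k)) (at (flip S p) within half_open_square)"
      by (rule has_derivative_transform[OF pm, rotated]) (use edge_dist_chart[of _ k S] in \<open>simp add: S a_def s_def\<close>)
    moreover have "(\<lambda>y::real^2. s * y $ edge_index k) \<noteq> (\<lambda>_. 0)"
    proof
      assume "(\<lambda>y::real^2. s * y $ edge_index k) = (\<lambda>_. 0)"
      from fun_cong[OF this, of "axis (edge_index k) 1"] show False by (auto simp: s_def split: if_splits)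
    qed
    ultimately show "\<exists>D. ((edge_dist k \<circ> chart_inv c) has_derivative D) (at (chart_map c p) within chart_image c) \<and>
        D \<noteq> (\<lambda>_. 0)"
      by (auto simp: S square_chart_image)
  qed
  ultimately show ?thesis
    unfolding boundary_defining_def by (auto simp: edge_def edge_dist_def)
qed

lemma compact_unit_square: "compact unit_square"
proof -
  have "unit_square = cbox 0 1" by (auto simp: unit_square_def mem_box_cart)
  then show ?thesis by (metis compact_cbox)
qed

lemma square_corner_data:
  assumes "\<And>i. 0 \<le> \<alpha> i"
  shows "corner_data (top_of_set unit_square) square_atlas 4 edge edge_dist (\<lambda>c p u v. u \<bullet> v) \<alpha>"
  unfolding corner_data_def
  using assms manifold_square riemannian_square square_hypersurfaces edge_embedded
    edge_boundary_defining compact_unit_square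
  by (simp add: compact_space_subtopology del: One_nat_def)

section \<open>The accessibility criterion\<close>

theorem proposition5p11:
  shows
    "(\<forall>(X::'x topology) (A::('x, 'e::euclidean_space) chart set) N H \<rho> g\<^sub>0 \<alpha> I.
        corner_data X A N H \<rho> g\<^sub>0 \<alpha> \<longrightarrow>
        I \<subseteq> {1..N} \<longrightarrow> I \<noteq> {} \<longrightarrow> open_face X N H I \<noteq> {} \<longrightarrow>
          (accessible X A (product_metric N \<rho> \<alpha> g\<^sub>0) (open_face X N H I) \<longleftrightarrow> (\<Sum>i\<in>I. \<alpha> i) < 2) \<and>
          (accessible X A (sum_metric N \<rho> \<alpha> g\<^sub>0) (open_face X N H I) \<longleftrightarrow> Max (\<alpha> ` I) < 2) \<and>
          ((\<forall>i\<in>I. \<alpha> i < 2) \<longrightarrow> accessible X A (sum_metric N \<rho> \<alpha> g\<^sub>0) (open_face X N H I)))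
     \<and> (\<exists>(X::(real^2) topology) (A::(real^2, real^2) chart set) N H \<rho> g\<^sub>0 \<alpha> I.
        corner_data X A N H \<rho> g\<^sub>0 \<alpha> \<and>
        I \<subseteq> {1..N} \<and> 2 \<le> card I \<and> open_face X N H I \<noteq> {} \<and>
        (\<forall>i\<in>I. accessible X A (product_metric N \<rho> \<alpha> g\<^sub>0) (open_face X N H {i})) \<and>
        \<not> accessible X A (product_metric N \<rho> \<alpha> g\<^sub>0) (open_face X N H I))"
proof (intro conjI allI impI)
  fix X :: "'x topology" and A :: "('x, 'e) chart set" and N H \<rho> g\<^sub>0 \<alpha> I
  assume "corner_data X A N H \<rho> g\<^sub>0 \<alpha>" and I: "I \<subseteq> {1..N}" "I \<noteq> {}" "open_face X N H I \<noteq> {}"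
  then interpret corner_interaction X A N H \<rho> g\<^sub>0 \<alpha> by unfold_locales
  show "accessible X A (product_metric N \<rho> \<alpha> g\<^sub>0) (open_face X N H I) \<longleftrightarrow> (\<Sum>i\<in>I. \<alpha> i) < 2"
    by (rule product_accessible_iff[OF I(2,3)])
  show sum: "accessible X A (sum_metric N \<rho> \<alpha> g\<^sub>0) (open_face X N H I) \<longleftrightarrow> Max (\<alpha> ` I) < 2"
    by (rule sum_accessible_iff[OF I(2,3)])
  assume "\<forall>i\<in>I. \<alpha> i < 2"
  then show "accessible X A (sum_metric N \<rho> \<alpha> g\<^sub>0) (open_face X N H I)"
    using sum I finite_subset[OF I(1) finite_atLeastAtMost] by simp
next
  let ?X = "top_of_set unit_square" and ?g = "\<lambda>c p u v :: real^2. u \<bullet> v" and ?\<alpha> = "\<lambda>_::nat. 1 :: real"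
  let ?A = square_atlas and ?P = "product_metric 4 edge_dist (\<lambda>_. 1) (\<lambda>c p u v. u \<bullet> v)"
  have data: "corner_data ?X square_atlas 4 edge edge_dist ?g ?\<alpha>"
    by (rule square_corner_data) simp
  then interpret corner_interaction ?X square_atlas 4 edge edge_dist ?g ?\<alpha>
    by unfold_locales
  \<comment> \<open>Each single exponent is \<open>1 < 2\<close>. The index is arbitrary, and an
    empty open face is accessible vacuously.\<close>
  have single: "accessible ?X ?A ?P (open_face ?X 4 edge {i})" for i
  proof (cases "open_face ?X 4 edge {i} = {}")
    case False
    then show ?thesis using product_accessible_iff[of "{i}"] by simp
  qed (simp add: accessible_def)
  \<comment> \<open>The origin is the corner of edges \<open>1\<close> and \<open>2\<close>; there
    the exponents add up to exactly the excluded value \<open>2\<close>.\<close>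
  have "0 \<in> open_face ?X 4 edge {1, 2}"
    by (auto simp: open_face_def active_set_def edge_def edge_value_def unit_square_def)
  then have ne: "open_face ?X 4 edge {1, 2} \<noteq> {}" by blast
  then have "\<not> accessible ?X ?A ?P (open_face ?X 4 edge {1, 2})"
    using product_accessible_iff[of "{1, 2}"] by simp
  with data single ne show "\<exists>(X::(real^2) topology) (A::(real^2, real^2) chart set) N H \<rho> g\<^sub>0 \<alpha> I.
        corner_data X A N H \<rho> g\<^sub>0 \<alpha> \<and>
        I \<subseteq> {1..N} \<and> 2 \<le> card I \<and> open_face X N H I \<noteq> {} \<and>
        (\<forall>i\<in>I. accessible X A (product_metric N \<rho> \<alpha> g\<^sub>0) (open_face X N H {i})) \<and>
        \<not> accessible X A (product_metric N \<rho> \<alpha> g\<^sub>0) (open_face X N H I)"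
    by (intro exI[of _ ?X] exI[of _ square_atlas] exI[of _ 4] exI[of _ edge] exI[of _ edge_dist]
        exI[of _ ?g] exI[of _ ?\<alpha>] exI[of _ "{1, 2}"]) simp
qed

end
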